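(* Let $d\ge2$, $-\frac2d<\gamma<0$, and let $n(t,x)$ be the solution of $$\frac{\partial n}{\partial t}=\nabla\cdot(n\nabla p)\quad\text{in }(0,\infty)\times\mathbb{R}^d,\qquad p=-n^\gamma,$$ with initial data $n(0,\cdot)=n_0\in L^1(\mathbb{R}^d)$, $n_0\ge0$. Then the pressure $p(t,x)=-n(t,x)^\gamma$ satisfies, for all $t>0$, $$\max_x\left|\nabla\sqrt{|p(t,x)|}\right|^2\le\frac{2\alpha}{t},\qquad\text{where }\alpha=\frac{1}{d\gamma+2}.$$ Moreover, the universal constant $2\alpha$ is optimal.
   Context: The equation is equivalent to the fast diffusion equation $\partial_t n=\frac{|\gamma|}{\gamma+1}\Delta n^{\gamma+1}$, i.e. the nonlinear diffusion equation $\partial_t n=\nabla\cdot(n\nabla(p+V))$ with trivial potential $V=0$ and pressure $p=\mathrm{sign}(\gamma)n^\gamma$. "The solution" is the unique nonnegative solution of the Cauchy problem on $\mathbb{R}^d$ with initial datum $n_0$.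
   Formalization: Optimality of 2α is false for |∇√|p||², since |∇√|p||² ≤ α/(2t) always holds; it is stated and proved for |∇p|²/|p| = 4|∇√|p||² ≤ 2α/t instead. The printed bound is kept. Solutions are positive and classical for t>0. *)

theory Defs
  imports "HOL-Analysis.Analysis"
begin

text \<open>Both operators are junk at points where the argument is not differentiable; they are only
  used together with differentiability.\<close>

definition grad :: "('a::euclidean_space \<Rightarrow> real) \<Rightarrow> 'a \<Rightarrow> 'a" where
  "grad f x = (\<Sum>b\<in>Basis. frechet_derivative f (at x) b *\<^sub>R b)"

definition divergence :: "('a::euclidean_space \<Rightarrow> 'a) \<Rightarrow> 'a \<Rightarrow> real" where
  "divergence F x = (\<Sum>b\<in>Basis. frechet_derivative F (at x) b \<bullet> b)"

lemma GDERIV_imp_grad: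
  fixes f :: "'a::euclidean_space \<Rightarrow> real"
  assumes "GDERIV f x :> D"
  shows "grad f x = D"
proof -
  have "(f has_derivative (\<lambda>h. h \<bullet> D)) (at x)"
    using assms by (simp add: gderiv_def)
  hence "frechet_derivative f (at x) = (\<lambda>h. h \<bullet> D)"
    by (rule frechet_derivative_at[symmetric])
  thus ?thesis
    by (simp add: grad_def inner_commute[of _ D] euclidean_representation)
qed

text \<open>\<open>n\<close> is a function of time and space.  Only its values at times \<open>t > 0\<close> matter.
  As \<open>\<gamma> < 0\<close>, the pressure is finite exactly where \<open>n\<close> is positive.\<close>

definition pressure :: "real \<Rightarrow> (real \<Rightarrow> 'a \<Rightarrow> real) \<Rightarrow> real \<Rightarrow> 'a \<Rightarrow> real" where
  "pressure \<gamma> n t x = - (n t x powr \<gamma>)"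

text \<open>Once continuously differentiable in time and twice in space on \<open>(0,\<infinity>) \<times> \<real>\<^sup>d\<close>,
  all these derivatives being jointly continuous.\<close>

definition C12 :: "(real \<Rightarrow> 'a::euclidean_space \<Rightarrow> real) \<Rightarrow> bool" where
  "C12 n \<longleftrightarrow>
     (\<forall>t>0. \<forall>x. (\<lambda>s. n s x) differentiable (at t)) \<and>
     (\<forall>t>0. \<forall>x. n t differentiable (at x)) \<and>
     (\<forall>t>0. \<forall>x. grad (n t) differentiable (at x)) \<and>
     continuous_on ({0<..} \<times> UNIV) (\<lambda>(t, x). n t x) \<and>
     continuous_on ({0<..} \<times> UNIV) (\<lambda>(t, x). deriv (\<lambda>s. n s x) t) \<and>
     continuous_on ({0<..} \<times> UNIV) (\<lambda>(t, x). grad (n t) x) \<and>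
     (\<forall>v. continuous_on ({0<..} \<times> UNIV) (\<lambda>(t, x). frechet_derivative (grad (n t)) (at x) v))"

text \<open>The solution of the Cauchy problem
  \<open>\<partial>\<^sub>t n = \<nabla>\<cdot>(n \<nabla>p)\<close>, \<open>p = -n\<^sup>\<gamma>\<close>, with initial datum \<open>n\<^sub>0\<close> in \<open>L\<^sup>1\<close>.
  In the range \<open>-2/d < \<gamma> < 0\<close> a nonnegative solution with a nontrivial datum is
  instantaneously positive and smooth, so the equation is read pointwise; the datum is attained
  in the sense of \<open>L\<^sup>1\<close>.\<close>

definition cauchy_solution ::
  "real \<Rightarrow> ('a::euclidean_space \<Rightarrow> real) \<Rightarrow> (real \<Rightarrow> 'a \<Rightarrow> real) \<Rightarrow> bool" where
  "cauchy_solution \<gamma> n0 n \<longleftrightarrow>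
     (\<forall>t>0. \<forall>x. n t x > 0) \<and>
     C12 n \<and>
     (\<forall>t>0. \<forall>x. ((\<lambda>s. n s x) has_real_derivative
        divergence (\<lambda>y. n t y *\<^sub>R grad (pressure \<gamma> n t) y) x) (at t)) \<and>
     (\<forall>t>0. integrable lborel (n t)) \<and>
     ((\<lambda>t. \<integral>x. \<bar>n t x - n0 x\<bar> \<partial>lborel) \<longlongrightarrow> 0) (at_right 0)"

end

theory Submission
  imports Defs
begin

text \<open>Write \<open>u = n\<^sup>\<gamma> = |p|\<close> and \<open>w = \<surd>u\<close>; then
  \<open>\<partial>\<^sub>t w = |\<gamma>| w\<^sup>2 \<Delta>w - (2 - |\<gamma>|) w |\<nabla>w|\<^sup>2\<close>, and the bound amounts to
  \<open>|\<nabla>w|\<^sup>2 \<le> \<alpha> / (2t)\<close>, because \<open>|\<nabla>p|\<^sup>2 / |p| = 4 |\<nabla>w|\<^sup>2\<close>.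
  A Bernstein argument would need third derivatives of \<open>n\<close>.  Doubling the space variable avoids
  them: at an interior maximum of \<open>e\<^sup>-\<^sup>L\<^sup>t ((w(x) - w(y))\<^sup>2 - M(t,x) |x - y|\<^sup>2)\<close>, testing the second order
  condition with the vectors \<open>(w(x) b, w(y) b)\<close> turns the equation into a contradiction as soon as
  \<open>M\<close> is a strict supersolution of \<open>\<partial>\<^sub>t M = - (2/\<alpha>) M\<^sup>2\<close> up to cutoff errors.  The cutoff is logarithmic in
  \<open>|x|\<close>, so its errors are scale invariant and vanish in the limit once \<open>u \<le> C (1 + |x|\<^sup>2)\<close> is known.
  That growth bound holds for every positive solution, by comparison with the
  singular solution \<open>\<alpha> |x|\<^sup>2 / (2t)\<close>.  Both arguments are run from a positive initial time \<open>s\<close>,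
  where the barrier is infinite, so that the initial datum plays no role.
  Equality is approached as \<open>|x| \<rightarrow> \<infinity>\<close> by the Barenblatt pressure \<open>A(t) + \<alpha> |x|\<^sup>2 / (2t)\<close>.\<close>

section \<open>Calculus\<close>

text \<open>The number 2/\<alpha> = 4 + 2 d \<gamma> arises at the maximum as follows. Without a
  cutoff, both gradients equal M (x - y) / D with D = w(x) - w(y). The gradient terms of the
  equation and the square in the second order condition together contribute -4 M^2 |x - y|^2 to the
  time derivative of D^2. The two test vectors differ by D b, and this mismatch costs 2 |\<gamma>| d
  M D^2, which is 2 |\<gamma>| d M^2 |x - y|^2 up to the excess of D^2 over M |x - y|^2. The sum is
  -(2/\<alpha>) M^2 |x - y|^2, negative exactly because d \<gamma> > -2. The factor e^(-L t) is
  there to absorb the excess. The same number governs growth: |\<gamma>| \<Delta> ln |x|^2 - (1 +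
  \<gamma>) |\<nabla> ln |x|^2|^2 = -(2/\<alpha>) / |x|^2, so the singular solution carries the same
  coefficient \<alpha>/2 as the sharp bound for |\<nabla>w|^2.\<close>

lemma second_derivative_test_max:
  fixes f f' :: "real \<Rightarrow> real"
  assumes f: "\<forall>\<^sub>F h in nhds 0. (f has_real_derivative f' h) (at h)"
    and f': "(f' has_real_derivative c) (at 0)"
    and mx: "\<forall>\<^sub>F h in nhds 0. f h \<le> f 0"
  shows "f' 0 = 0" "c \<le> 0"
proof -
  obtain d where d: "d > 0" "\<And>h. \<bar>h\<bar> < d \<Longrightarrow> (f has_real_derivative f' h) (at h) \<and> f h \<le> f 0"
    using eventually_conj[OF f mx] unfolding eventually_nhds_metric by (auto simp: dist_real_def)
  have "(f has_real_derivative f' 0) (at 0)" using d by simp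
  then show z: "f' 0 = 0"
    by (rule DERIV_local_max[of _ _ _ d]) (use d in auto)
  show "c \<le> 0"
  proof (rule ccontr)
    assume "\<not> c \<le> 0"
    then obtain e where e: "e > 0" "\<And>h. 0 < h \<Longrightarrow> h < e \<Longrightarrow> f' 0 < f' (0 + h)"
      using DERIV_pos_inc_right[OF f'] by force
    define k where "k = min d e / 2"
    have k: "0 < k" "k < d" "k < e" using d(1) e(1) by (auto simp: k_def min_def)
    obtain \<xi> where "0 < \<xi>" "\<xi> < k" "f k - f 0 = (k - 0) * f' \<xi>"
      using MVT2[of 0 k f f'] k d by (metis abs_of_nonneg order_le_less_trans)
    moreover have "f' \<xi> > 0" using e(2)[of \<xi>] z k \<open>0 < \<xi>\<close> \<open>\<xi> < k\<close> by simp
    ultimately have "f k > f 0" using k by (simp add: zero_less_mult_iff algebra_simps)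
    with d(2)[of k] k show False by simp
  qed
qed

text \<open>A maximum over a closed time interval may sit at its final time, so only comparison with
  earlier times is available.\<close>

lemma left_max_derivative_nonneg:
  fixes f :: "real \<Rightarrow> real"
  assumes f: "(f has_real_derivative c) (at t)" and "s < t"
    and mx: "\<And>r. s < r \<Longrightarrow> r < t \<Longrightarrow> f r \<le> f t"
  shows "c \<ge> 0"
proof (rule ccontr)
  assume "\<not> c \<ge> 0"
  then obtain e where e: "e > 0" "\<And>h. 0 < h \<Longrightarrow> h < e \<Longrightarrow> f t < f (t - h)"
    using DERIV_neg_dec_left[OF f] by force
  define k where "k = min e (t - s) / 2"
  have "0 < k" "k < e" "s < t - k" "t - k < t" using e(1) \<open>s < t\<close> by (auto simp: k_def min_def field_simps)
  then show False using e(2)[of k] mx[of "t - k"] by simp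
qed

section \<open>Derivatives of powers of the density and of the nonlinear flux\<close>

lemma has_derivative_grad:
  fixes f :: "'a::euclidean_space \<Rightarrow> real"
  assumes "f differentiable (at x)"
  shows "(f has_derivative (\<lambda>h. h \<bullet> grad f x)) (at x)"
proof -
  have d: "(f has_derivative frechet_derivative f (at x)) (at x)"
    using assms by (simp add: frechet_derivative_works)
  have "frechet_derivative f (at x) h = h \<bullet> grad f x" for h
  proof -
    have "linear (frechet_derivative f (at x))" using d has_derivative_linear by blast
    then have "frechet_derivative f (at x) h = (\<Sum>b\<in>Basis. (h \<bullet> b) * frechet_derivative f (at x) b)"
      by (subst euclidean_representation[of h, symmetric]) (simp add: linear_sum linear_cmul)
    then show ?thesis by (simp add: grad_def inner_sum_right mult.commute)
  qed
  then show ?thesis using d by (metis ext)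
qed

lemma has_derivative_imp_grad:
  fixes f :: "'a::euclidean_space \<Rightarrow> real"
  assumes "(f has_derivative (\<lambda>h. h \<bullet> D)) (at x)"
  shows "grad f x = D"
  using GDERIV_imp_grad[of f x D] assms by (simp add: gderiv_def)

lemma has_derivative_imp_divergence:
  assumes "(F has_derivative D) (at x)"
  shows "divergence F x = (\<Sum>b\<in>Basis. D b \<bullet> b)"
  unfolding divergence_def frechet_derivative_at[OF assms, symmetric] ..

lemma has_derivative_powr_const:
  fixes f :: "'a::real_normed_vector \<Rightarrow> real"
  assumes "(f has_derivative f') (at x)" "f x > 0"
  shows "((\<lambda>y. f y powr r) has_derivative (\<lambda>h. r * f x powr (r - 1) * f' h)) (at x)"
proof -
  have "((\<lambda>z. z powr r) has_field_derivative r * f x powr (r - 1)) (at (f x))"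
    using assms(2) by (rule has_real_derivative_powr)
  then have "((\<lambda>z. z powr r) has_derivative (\<lambda>h. r * f x powr (r - 1) * h)) (at (f x))"
    by (simp add: has_field_derivative_def)
  from has_derivative_compose[OF assms(1) this] show ?thesis .
qed

lemma has_derivative_grad_pressure:
  fixes n :: "real \<Rightarrow> 'a::euclidean_space \<Rightarrow> real"
  assumes "(n t has_derivative (\<lambda>h. h \<bullet> g)) (at x)" "n t x > 0"
  shows "grad (pressure \<gamma> n t) x = (- \<gamma> * n t x powr (\<gamma> - 1)) *\<^sub>R g"
proof (rule has_derivative_imp_grad)
  show "(pressure \<gamma> n t has_derivative (\<lambda>h. h \<bullet> (- \<gamma> * n t x powr (\<gamma> - 1)) *\<^sub>R g)) (at x)"
    using has_derivative_minus[OF has_derivative_powr_const[OF assms, of \<gamma>]]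
    unfolding pressure_def[abs_def] by (simp add: algebra_simps)
qed

text \<open>The flux equals -\<gamma> n^\<gamma> \<nabla>n, a scalar power times the gradient, so
  one product rule at \<open>x\<close> gives the nondivergence form of the equation.\<close>

lemma divergence_flux:
  fixes n :: "real \<Rightarrow> 'a::euclidean_space \<Rightarrow> real"
  assumes n: "\<And>y. (n t has_derivative (\<lambda>h. h \<bullet> g y)) (at y)" and pos: "\<And>y. n t y > 0"
    and g: "(g has_derivative A) (at x)"
  shows "divergence (\<lambda>y. n t y *\<^sub>R grad (pressure \<gamma> n t) y) x =
    - \<gamma> * (\<gamma> * n t x powr (\<gamma> - 1) * (g x \<bullet> g x) + n t x powr \<gamma> * (\<Sum>b\<in>Basis. A b \<bullet> b))"
proof -
  have "(\<lambda>y. n t y *\<^sub>R grad (pressure \<gamma> n t) y) = (\<lambda>y. - \<gamma> *\<^sub>R (n t y powr \<gamma> *\<^sub>R g y))"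
  proof
    fix y
    have "n t y * n t y powr (\<gamma> - 1) = n t y powr \<gamma>"
      using pos[of y] by (simp add: powr_diff)
    then have "n t y * (\<gamma> * n t y powr (\<gamma> - 1)) = \<gamma> * n t y powr \<gamma>"
      by (metis mult.left_commute)
    then show "n t y *\<^sub>R grad (pressure \<gamma> n t) y = - \<gamma> *\<^sub>R (n t y powr \<gamma> *\<^sub>R g y)"
      by (simp add: has_derivative_grad_pressure[where n = n and t = t, OF n pos])
  qed
  moreover have "((\<lambda>y. - \<gamma> *\<^sub>R (n t y powr \<gamma> *\<^sub>R g y)) has_derivative
      (\<lambda>h. - \<gamma> *\<^sub>R (n t x powr \<gamma> *\<^sub>R A h + (\<gamma> * n t x powr (\<gamma> - 1) * (h \<bullet> g x)) *\<^sub>R g x))) (at x)"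
    by (intro has_derivative_scaleR_right has_derivative_scaleR g has_derivative_powr_const n pos)
  ultimately have "divergence (\<lambda>y. n t y *\<^sub>R grad (pressure \<gamma> n t) y) x =
     (\<Sum>b\<in>Basis. (- \<gamma> *\<^sub>R (n t x powr \<gamma> *\<^sub>R A b + (\<gamma> * n t x powr (\<gamma> - 1) * (b \<bullet> g x)) *\<^sub>R g x)) \<bullet> b)"
    by (simp only: has_derivative_imp_divergence)
  also have "\<dots> = - \<gamma> * (n t x powr \<gamma> * (\<Sum>b\<in>Basis. A b \<bullet> b)
      + \<gamma> * n t x powr (\<gamma> - 1) * (\<Sum>b\<in>Basis. (g x \<bullet> b) * (g x \<bullet> b)))"
    by (simp add: inner_add_left sum.distrib sum_distrib_left sum_negf sum_subtractf algebra_simps inner_commute)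
  also have "(\<Sum>b\<in>Basis. (g x \<bullet> b) * (g x \<bullet> b)) = g x \<bullet> g x"
    by (rule euclidean_inner[symmetric])
  finally show ?thesis by (simp add: algebra_simps)
qed

section \<open>Basis sums, and radial functions restricted to lines\<close>

lemma sum_Basis_inner_sq: "(\<Sum>b\<in>Basis. (b \<bullet> v)\<^sup>2) = v \<bullet> v" for v :: "'a::euclidean_space"
proof -
  have "v \<bullet> v = (\<Sum>b\<in>Basis. (v \<bullet> b) * (v \<bullet> b))" by (rule euclidean_inner)
  also have "\<dots> = (\<Sum>b\<in>Basis. (b \<bullet> v)\<^sup>2)"
    by (rule sum.cong) (simp_all add: power2_eq_square inner_commute)
  finally show ?thesis ..
qed

lemma sum_Basis_inner_prod: "(\<Sum>b\<in>Basis. (b \<bullet> u) * (b \<bullet> v)) = u \<bullet> v" for u v :: "'a::euclidean_space"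
  unfolding euclidean_inner[of u v] by (rule sum.cong) (simp_all add: inner_commute)

text \<open>Radial weights are written as functions of the squared norm, which is smooth at the
  origin; along a line they become one-variable functions.\<close>

lemma norm_sq_line_derivative:
  fixes x \<xi> :: "'a::real_inner"
  shows "((\<lambda>h::real. (x + h *\<^sub>R \<xi>) \<bullet> (x + h *\<^sub>R \<xi>)) has_real_derivative 2 * (\<xi> \<bullet> (x + h *\<^sub>R \<xi>))) (at h)"
proof -
  have "(\<lambda>h::real. (x + h *\<^sub>R \<xi>) \<bullet> (x + h *\<^sub>R \<xi>)) = (\<lambda>h. x \<bullet> x + 2 * h * (x \<bullet> \<xi>) + h * h * (\<xi> \<bullet> \<xi>))"
    by (auto simp: algebra_simps inner_commute)
  then show ?thesis
    by (auto intro!: derivative_eq_intros simp: algebra_simps inner_commute)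
qed

lemma radial_line_derivative:
  fixes x \<xi> :: "'a::real_inner"
  assumes "(\<psi> has_real_derivative \<psi>') (at ((x + h *\<^sub>R \<xi>) \<bullet> (x + h *\<^sub>R \<xi>)))"
  shows "((\<lambda>h::real. \<psi> ((x + h *\<^sub>R \<xi>) \<bullet> (x + h *\<^sub>R \<xi>))) has_real_derivative \<psi>' * (2 * (\<xi> \<bullet> (x + h *\<^sub>R \<xi>)))) (at h)"
  using DERIV_chain2[OF assms norm_sq_line_derivative] .

lemma radial_line_second_derivative:
  fixes x \<xi> :: "'a::real_inner"
  assumes "(\<psi>' has_real_derivative \<psi>'') (at (x \<bullet> x))"
  shows "((\<lambda>h::real. \<psi>' ((x + h *\<^sub>R \<xi>) \<bullet> (x + h *\<^sub>R \<xi>)) * (2 * (\<xi> \<bullet> (x + h *\<^sub>R \<xi>)))) has_real_derivative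
    \<psi>'' * (4 * (\<xi> \<bullet> x)\<^sup>2) + \<psi>' (x \<bullet> x) * (2 * (\<xi> \<bullet> \<xi>))) (at 0)"
proof -
  have "((\<lambda>h::real. \<psi>' ((x + h *\<^sub>R \<xi>) \<bullet> (x + h *\<^sub>R \<xi>))) has_real_derivative \<psi>'' * (2 * (\<xi> \<bullet> x))) (at 0)"
    using radial_line_derivative[of \<psi>' \<psi>'' x 0 \<xi>] assms by simp
  moreover have "((\<lambda>h::real. 2 * (\<xi> \<bullet> (x + h *\<^sub>R \<xi>))) has_real_derivative 2 * (\<xi> \<bullet> \<xi>)) (at 0)"
    by (auto simp: inner_add_right intro!: derivative_eq_intros)
  ultimately show ?thesis
    by (auto intro!: derivative_eq_intros simp: power2_eq_square algebra_simps)
qed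

section \<open>Growth of the pressure\<close>

text \<open>\<open>G\<close> and \<open>A\<close> are the gradient and Hessian of \<open>n\<close>.
  With the flux expanded once and for all, every later argument treats their values at a point as
  algebraic unknowns.\<close>

locale fast_diffusion =
  fixes n :: "real \<Rightarrow> 'a::euclidean_space \<Rightarrow> real" and \<gamma> :: real
    and G :: "real \<Rightarrow> 'a \<Rightarrow> 'a" and A :: "real \<Rightarrow> 'a \<Rightarrow> 'a \<Rightarrow> 'a"
  assumes dim: "DIM('a) \<ge> 2"
    and gamma: "- 2 / real DIM('a) < \<gamma>" "\<gamma> < 0"
    and pos: "t > 0 \<Longrightarrow> n t x > 0"
    and deriv_n: "t > 0 \<Longrightarrow> (n t has_derivative (\<lambda>h. h \<bullet> G t x)) (at x)"
    and deriv_G: "t > 0 \<Longrightarrow> (G t has_derivative A t x) (at x)"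
    and cont_n: "continuous_on ({0<..} \<times> UNIV) (\<lambda>(t, x). n t x)"
    and cont_G: "continuous_on ({0<..} \<times> UNIV) (\<lambda>(t, x). G t x)"
    and pde: "t > 0 \<Longrightarrow> ((\<lambda>s. n s x) has_real_derivative
        - \<gamma> * (\<gamma> * n t x powr (\<gamma> - 1) * (G t x \<bullet> G t x) + n t x powr \<gamma> * (\<Sum>b\<in>Basis. A t x b \<bullet> b))) (at t)"

lemma cauchy_solution_imp_fast_diffusion:
  fixes n :: "real \<Rightarrow> 'a::euclidean_space \<Rightarrow> real"
  assumes "DIM('a) \<ge> 2" "- 2 / real DIM('a) < \<gamma>" "\<gamma> < 0" and c: "cauchy_solution \<gamma> n0 n"
  shows "fast_diffusion n \<gamma> (\<lambda>t. grad (n t)) (\<lambda>t x. frechet_derivative (grad (n t)) (at x))"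
proof
  have C: "C12 n" and p: "\<And>t x. t > 0 \<Longrightarrow> n t x > 0" using c by (auto simp: cauchy_solution_def)
  show a: "(n t has_derivative (\<lambda>h. h \<bullet> grad (n t) x)) (at x)" if "t > 0" for t x
    by (rule has_derivative_grad) (use C that in \<open>auto simp: C12_def\<close>)
  show b: "(grad (n t) has_derivative frechet_derivative (grad (n t)) (at x)) (at x)" if "t > 0" for t x
    using C that by (auto simp: C12_def frechet_derivative_works)
  fix t :: real and x assume t: "t > 0"
  have "((\<lambda>s. n s x) has_real_derivative divergence (\<lambda>y. n t y *\<^sub>R grad (pressure \<gamma> n t) y) x) (at t)"
    using c t by (auto simp: cauchy_solution_def)
  then show "((\<lambda>s. n s x) has_real_derivative - \<gamma> * (\<gamma> * n t x powr (\<gamma> - 1) * (grad (n t) x \<bullet> grad (n t) x)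
     + n t x powr \<gamma> * (\<Sum>b\<in>Basis. frechet_derivative (grad (n t)) (at x) b \<bullet> b))) (at t)"
    by (subst (asm) divergence_flux[where n = n and t = t, OF a[OF t] p[OF t] b[OF t]])
qed (use assms in \<open>auto simp: C12_def cauchy_solution_def\<close>)

context fast_diffusion
begin

text \<open>The first quantity is 2/\<alpha>, the decay rate in both comparison arguments. The last
  bound combines d |\<gamma>| < 2 with |\<gamma>| < 1; it fixes the sign of the term linear in the
  logarithmic correction of the barrier.\<close>

lemma gamma_bound: "0 < 4 + 2 * real DIM('a) * \<gamma>" "-1 < \<gamma>" "(2 * real DIM('a) + 4) * - \<gamma> \<le> 8"
proof -
  have d: "real DIM('a) \<ge> 2" using dim by linarith
  have dg: "- 2 < real DIM('a) * \<gamma>" using gamma(1) d by (simp add: field_simps)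
  then show "0 < 4 + 2 * real DIM('a) * \<gamma>" by simp
  have "- 2 / 2 \<le> - 2 / real DIM('a)" using d by (simp add: field_simps)
  then show "-1 < \<gamma>" using gamma by linarith
  then show "(2 * real DIM('a) + 4) * - \<gamma> \<le> 8" using dg by (simp add: algebra_simps)
qed

section \<open>Functions of the density along lines and in time\<close>

lemma line_derivative:
  assumes t: "t > 0" and \<phi>: "\<And>z. z > 0 \<Longrightarrow> (\<phi> has_real_derivative \<phi>' z) (at z)"
  shows "((\<lambda>h. \<phi> (n t (x + h *\<^sub>R \<xi>))) has_real_derivative
    \<phi>' (n t (x + h *\<^sub>R \<xi>)) * (\<xi> \<bullet> G t (x + h *\<^sub>R \<xi>))) (at h)"
proof -
  have "((\<lambda>h. x + h *\<^sub>R \<xi>) has_derivative (\<lambda>k. k *\<^sub>R \<xi>)) (at h)"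
    by (auto intro!: derivative_eq_intros)
  from has_derivative_compose[OF this deriv_n[OF t]]
  have "((\<lambda>h. n t (x + h *\<^sub>R \<xi>)) has_real_derivative (\<xi> \<bullet> G t (x + h *\<^sub>R \<xi>))) (at h)"
    by (simp add: has_field_derivative_def mult_commute_abs)
  from DERIV_chain2[OF \<phi>[OF pos[OF t]] this] show ?thesis .
qed

lemma line_second_derivative:
  assumes t: "t > 0" and \<phi>: "\<And>z. z > 0 \<Longrightarrow> (\<phi>' has_real_derivative \<phi>'' z) (at z)"
  shows "((\<lambda>h. \<phi>' (n t (x + h *\<^sub>R \<xi>)) * (\<xi> \<bullet> G t (x + h *\<^sub>R \<xi>))) has_real_derivative
    \<phi>'' (n t x) * (\<xi> \<bullet> G t x)\<^sup>2 + \<phi>' (n t x) * (\<xi> \<bullet> A t x \<xi>)) (at 0)"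
proof -
  have l: "((\<lambda>h. x + h *\<^sub>R \<xi>) has_derivative (\<lambda>k. k *\<^sub>R \<xi>)) (at 0)"
    by (auto intro!: derivative_eq_intros)
  have "linear (A t x)" using deriv_G[OF t] has_derivative_linear by blast
  then have a: "A t x (k *\<^sub>R \<xi>) = k *\<^sub>R A t x \<xi>" for k by (rule linear_cmul)
  have "((\<lambda>h. G t (x + h *\<^sub>R \<xi>)) has_derivative (\<lambda>k. A t x (k *\<^sub>R \<xi>))) (at 0)"
    using has_derivative_compose[OF l] deriv_G[OF t, of x] by simp
  then have "((\<lambda>h. \<xi> \<bullet> G t (x + h *\<^sub>R \<xi>)) has_real_derivative (\<xi> \<bullet> A t x \<xi>)) (at 0)"
    unfolding has_field_derivative_def a
    by (auto intro!: derivative_eq_intros simp: mult.commute)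
  moreover have "((\<lambda>h. \<phi>' (n t (x + h *\<^sub>R \<xi>))) has_real_derivative \<phi>'' (n t x) * (\<xi> \<bullet> G t x)) (at 0)"
    using line_derivative[OF t \<phi>, of x \<xi> 0] by simp
  ultimately show ?thesis
    by (auto intro!: derivative_eq_intros simp: power2_eq_square algebra_simps)
qed

lemma continuous_on_powr_n:
  "continuous_on ({0<..} \<times> UNIV) (\<lambda>z. n (fst z) (snd z) powr r)"
proof (rule continuous_on_powr)
  show "continuous_on ({0<..} \<times> UNIV) (\<lambda>z. n (fst z) (snd z))"
    using cont_n by (simp add: split_def)
  show "\<forall>z\<in>{0<..} \<times> UNIV. n (fst z) (snd z) \<noteq> 0"
  proof
    fix z :: "real \<times> 'a" assume "z \<in> {0<..} \<times> UNIV"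
    then show "n (fst z) (snd z) \<noteq> 0" using pos[of "fst z" "snd z"] by auto
  qed
qed (rule continuous_on_const)

lemma time_derivative:
  assumes t: "t > 0" and \<phi>: "\<And>z. z > 0 \<Longrightarrow> (\<phi> has_real_derivative \<phi>' z) (at z)"
  shows "((\<lambda>s. \<phi> (n s x)) has_real_derivative \<phi>' (n t x) *
     (- \<gamma> * (\<gamma> * n t x powr (\<gamma> - 1) * (G t x \<bullet> G t x) + n t x powr \<gamma> * (\<Sum>b\<in>Basis. A t x b \<bullet> b)))) (at t)"
  using DERIV_chain2[OF \<phi>[OF pos[OF t]] pde[OF t]] .

text \<open>The comparison function is the singular solution, multiplied by a power of
  \<open>1 - \<nu> ln |x|\<^sup>2\<close> which makes it infinite on a large sphere.  The exponent \<open>k\<close> is the one for which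
  the quadratic terms produced by this factor cancel, and the summand \<open>K\<close> makes it dominate on the
  unit sphere.\<close>

lemma log_barrier:
  assumes s: "0 < s" and K: "0 < K" and \<nu>: "0 < \<nu>"
    and sphere: "\<And>t x. s \<le> t \<Longrightarrow> t \<le> T \<Longrightarrow> x \<bullet> x = 1 \<Longrightarrow> n t x powr \<gamma> \<le> K"
    and k: "k = - \<gamma> / (1 + \<gamma>)" and a: "a = 1 / (4 + 2 * real DIM('a) * \<gamma>)"
    and t1: "s < t1" "t1 \<le> T" and x1: "1 \<le> x1 \<bullet> x1" "\<nu> * ln (x1 \<bullet> x1) < 1"
  shows "n t1 x1 powr \<gamma> * (1 - \<nu> * ln (x1 \<bullet> x1)) powr k \<le> (K + a / (t1 - s)) * (x1 \<bullet> x1)"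
proof (rule ccontr)
  assume contra: "\<not> ?thesis"
  have g1: "1 + \<gamma> > 0" using gamma_bound by simp
  have kpos: "k > 0" using gamma g1 by (simp add: k divide_neg_pos)
  have apos: "a > 0" using gamma_bound by (simp add: a)
  have den: "K * r + a > 0" if "r \<ge> 0" for r using K apos that by (simp add: add_nonneg_pos)
  \<comment> \<open>\<open>Z\<close> is the quotient of u = n^\<gamma> by the barrier. Clearing the
    denominator \<open>t - s\<close> lets it extend continuously, with value 0, to the initial time
    and to the outer sphere, where the barrier is infinite.\<close>
  define Z where "Z = (\<lambda>(t, x). n t x powr \<gamma> * (t - s) * (1 - \<nu> * ln (x \<bullet> x)) powr k / ((K * (t - s) + a) * (x \<bullet> x)))"
  define S where "S = {s..T} \<times> {x::'a. 1 \<le> x \<bullet> x \<and> \<nu> * ln (x \<bullet> x) \<le> 1}"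
  have lnle: "\<nu> * ln r \<le> 1 \<longleftrightarrow> r \<le> exp (1 / \<nu>)" if "r \<ge> 1" for r
  proof -
    have "\<nu> * ln r \<le> 1 \<longleftrightarrow> ln r \<le> ln (exp (1 / \<nu>))" using \<nu> by (simp add: field_simps)
    also have "\<dots> \<longleftrightarrow> r \<le> exp (1 / \<nu>)" using that by (subst ln_le_cancel_iff) auto
    finally show ?thesis .
  qed
  have S_alt: "S = {s..T} \<times> ({x. 1 \<le> x \<bullet> x} \<inter> {x. x \<bullet> x \<le> exp (1 / \<nu>)})"
    using lnle by (auto simp: S_def)
  have "compact ({x::'a. 1 \<le> x \<bullet> x} \<inter> {x. x \<bullet> x \<le> exp (1 / \<nu>)})"
  proof -
    have "closed ({x::'a. 1 \<le> x \<bullet> x} \<inter> {x. x \<bullet> x \<le> exp (1 / \<nu>)})"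
      by (intro closed_Int closed_Collect_le continuous_intros)
    moreover have "bounded ({x::'a. 1 \<le> x \<bullet> x} \<inter> {x. x \<bullet> x \<le> exp (1 / \<nu>)})"
      by (rule bounded_subset[of "cball 0 (sqrt (exp (1 / \<nu>)))"])
        (auto simp: norm_eq_sqrt_inner)
    ultimately show ?thesis by (simp add: compact_eq_bounded_closed)
  qed
  then have cS: "compact S" unfolding S_alt by (intro compact_Times) auto
  have contZ: "continuous_on S Z"
  proof -
    have "continuous_on S (\<lambda>z. n (fst z) (snd z) powr \<gamma>)"
      by (rule continuous_on_subset[OF continuous_on_powr_n]) (use s in \<open>auto simp: S_def\<close>)
    moreover have nz: "snd z \<bullet> snd z \<noteq> 0" if "z \<in> S" for z using that by (auto simp: S_def)
    moreover have "continuous_on S (\<lambda>z. (1 - \<nu> * ln (snd z \<bullet> snd z)) powr k)"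
    proof (rule continuous_on_powr')
      show "\<forall>z\<in>S. 0 \<le> 1 - \<nu> * ln (snd z \<bullet> snd z) \<and> (1 - \<nu> * ln (snd z \<bullet> snd z) = 0 \<longrightarrow> 0 < k)"
        using kpos by (auto simp: S_def)
      show "continuous_on S (\<lambda>z. 1 - \<nu> * ln (snd z \<bullet> snd z))"
        by (intro continuous_intros ballI) (use nz in auto)
    qed (rule continuous_on_const)
    moreover have "(K * (fst z - s) + a) * (snd z \<bullet> snd z) \<noteq> 0" if "z \<in> S" for z
    proof -
      have "fst z - s \<ge> 0" using that by (auto simp: S_def)
      from den[OF this] nz[OF that] show ?thesis by (metis mult_eq_0_iff less_irrefl)
    qed
    ultimately show ?thesis
      unfolding Z_def split_def
      by (intro continuous_on_divide continuous_on_mult continuous_on_diff continuous_on_add continuous_on_inner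
        continuous_on_const continuous_on_fst continuous_on_snd continuous_on_id) (blast+)
  qed
  have in1: "(t1, x1) \<in> S" using t1 x1 by (auto simp: S_def)
  obtain t x where tx: "(t, x) \<in> S" and mx: "\<And>r y. (r, y) \<in> S \<Longrightarrow> Z (r, y) \<le> Z (t, x)"
    using continuous_attains_sup[OF cS _ contZ] in1 by (metis empty_iff surj_pair)
  have "Z (t1, x1) > 1"
  proof -
    have "(K * (t1 - s) + a) * (x1 \<bullet> x1) = (K + a / (t1 - s)) * (x1 \<bullet> x1) * (t1 - s)"
      using t1 by (simp add: field_simps)
    also have "\<dots> < n t1 x1 powr \<gamma> * (t1 - s) * (1 - \<nu> * ln (x1 \<bullet> x1)) powr k"
      using contra t1 by (simp add: mult.commute mult.left_commute not_le)
    finally have *: "(K * (t1 - s) + a) * (x1 \<bullet> x1) < n t1 x1 powr \<gamma> * (t1 - s) * (1 - \<nu> * ln (x1 \<bullet> x1)) powr k" .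
    have "(K * (t1 - s) + a) * (x1 \<bullet> x1) > 0" using den[of "t1 - s"] t1 x1 by (intro mult_pos_pos) auto
    then show ?thesis using * by (simp add: Z_def less_divide_eq)
  qed
  then have Z1: "Z (t, x) > 1" using mx[OF in1] by simp
  define \<rho> where "\<rho> = x \<bullet> x"
  have "s \<noteq> t" using Z1 by (auto simp: Z_def)
  then have st: "s < t" "t \<le> T" using tx by (auto simp: S_def)
  have t0: "t > 0" using s st by simp
  have "1 - \<nu> * ln \<rho> \<noteq> 0" using Z1 by (auto simp: Z_def \<rho>_def)
  then have e0: "0 < 1 - \<nu> * ln \<rho>" using tx by (auto simp: S_def \<rho>_def)
  \<comment> \<open>Outside the unit ball the logarithmic factor is at most 1, so
    \<open>Z > 1\<close> already puts u above the uncorrected barrier. This excludes the unit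
    sphere, and later makes the decay rate strictly too large.\<close>
  have u: "n t x powr \<gamma> > (K + a / (t - s)) * \<rho>"
  proof -
    have "\<rho> \<ge> 1" using tx by (auto simp: S_def \<rho>_def)
    then have "1 - \<nu> * ln \<rho> \<le> 1" using \<nu> by simp
    then have "(1 - \<nu> * ln \<rho>) powr k \<le> 1" using e0 kpos by (intro powr_le1) auto
    then have "n t x powr \<gamma> * (t - s) * (1 - \<nu> * ln \<rho>) powr k \<le> n t x powr \<gamma> * (t - s)"
      using st by (intro mult_left_le) auto
    moreover have "(K * (t - s) + a) * \<rho> > 0"
      using den[of "t - s"] st \<open>\<rho> \<ge> 1\<close> by (intro mult_pos_pos) auto
    then have "(K * (t - s) + a) * \<rho> < n t x powr \<gamma> * (t - s) * (1 - \<nu> * ln \<rho>) powr k"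
      using Z1 by (simp add: Z_def \<rho>_def less_divide_eq)
    ultimately have "(K * (t - s) + a) * \<rho> < n t x powr \<gamma> * (t - s)" by linarith
    moreover have "(K * (t - s) + a) * \<rho> = (K + a / (t - s)) * \<rho> * (t - s)"
      using st by (simp add: field_simps)
    ultimately show ?thesis using st by simp
  qed
  have \<rho>1: "\<rho> > 1"
  proof -
    have "\<rho> \<ge> 1" using tx by (auto simp: S_def \<rho>_def)
    moreover have "\<rho> \<noteq> 1"
    proof
      assume "\<rho> = 1"
      then have "n t x powr \<gamma> \<le> K" using sphere[of t x] st by (simp add: \<rho>_def)
      moreover have "a / (t - s) > 0" using apos st by simp
      ultimately show False using u \<open>\<rho> = 1\<close> by simp
    qed
    ultimately show ?thesis by simp
  qed
  \<comment> \<open>\<open>\<psi>\<close> is the logarithm of the spatial part of the barrier. The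
    quantity \<open>m\<close> satisfies m' = m^2 / (k r), so both derivatives of
    \<open>\<psi>\<close> are polynomial in \<open>m\<close>.\<close>
  define \<psi> where "\<psi> = (\<lambda>r. ln r - k * ln (1 - \<nu> * ln r))"
  define m where "m = (\<lambda>r. k * \<nu> / (1 - \<nu> * ln r))"
  define \<psi>' where "\<psi>' = (\<lambda>r. (1 + m r) / r)"
  define \<psi>'' where "\<psi>'' = (m \<rho> ^ 2 / k - (1 + m \<rho>)) / \<rho>\<^sup>2"
  have d\<psi>: "(\<psi> has_real_derivative \<psi>' r) (at r)" if "r > 0" "1 - \<nu> * ln r > 0" for r
    unfolding \<psi>_def using that
    by (auto intro!: derivative_eq_intros simp: \<psi>'_def m_def field_simps)
  have d\<psi>': "(\<psi>' has_real_derivative \<psi>'') (at \<rho>)"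
  proof -
    have "(m has_real_derivative k * \<nu> * \<nu> / (\<rho> * (1 - \<nu> * ln \<rho>)\<^sup>2)) (at \<rho>)"
      unfolding m_def using \<rho>1 e0
      by (auto intro!: derivative_eq_intros simp: power2_eq_square)
    then have "(\<psi>' has_real_derivative ((k * \<nu> * \<nu> / (\<rho> * (1 - \<nu> * ln \<rho>)\<^sup>2)) * \<rho> - (1 + m \<rho>)) / (\<rho> * \<rho>)) (at \<rho>)"
      unfolding \<psi>'_def using \<rho>1 by (auto intro!: derivative_eq_intros)
    moreover have "(k * \<nu> * \<nu> / (\<rho> * (1 - \<nu> * ln \<rho>)\<^sup>2)) * \<rho> = m \<rho> ^ 2 / k"
      using kpos \<rho>1 by (simp add: m_def power2_eq_square)
    ultimately show ?thesis by (simp add: \<psi>''_def power2_eq_square)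
  qed
  define N where "N = n t x"
  have N: "N > 0" using pos t0 by (simp add: N_def)
  have cc: "open {y::'a. 1 < y \<bullet> y \<and> \<nu> * ln (y \<bullet> y) < 1}"
  proof -
    have "{y::'a. 1 < y \<bullet> y \<and> \<nu> * ln (y \<bullet> y) < 1} = {y. 1 < y \<bullet> y} \<inter> {y. y \<bullet> y < exp (1 / \<nu>)}"
    proof -
      have "\<nu> * ln r < 1 \<longleftrightarrow> r < exp (1 / \<nu>)" if "r > 1" for r
      proof -
        have "\<nu> * ln r < 1 \<longleftrightarrow> ln r < ln (exp (1 / \<nu>))" using \<nu> by (simp add: field_simps)
        also have "\<dots> \<longleftrightarrow> r < exp (1 / \<nu>)" using that by (subst ln_less_cancel_iff) auto
        finally show ?thesis .
      qed
      then show ?thesis by auto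
    qed
    then show ?thesis by (auto intro!: open_Int open_Collect_less continuous_intros)
  qed
  have line: "\<forall>\<^sub>F h in nhds 0. x + h *\<^sub>R b \<in> {y. 1 < y \<bullet> y \<and> \<nu> * ln (y \<bullet> y) < 1}" for b :: 'a
  proof -
    have "((\<lambda>h. x + h *\<^sub>R b) \<longlongrightarrow> x + 0 *\<^sub>R b) (nhds 0)"
      by (intro tendsto_intros filterlim_ident)
    then show ?thesis using cc \<rho>1 e0 by (intro topological_tendstoD) (auto simp: \<rho>_def)
  qed
  have spatial: "\<gamma> / N * (b \<bullet> G t x) = \<psi>' \<rho> * (2 * (b \<bullet> x))"
     "- \<gamma> / N\<^sup>2 * (b \<bullet> G t x)\<^sup>2 + \<gamma> / N * (b \<bullet> A t x b) \<le> \<psi>'' * (4 * (b \<bullet> x)\<^sup>2) + \<psi>' \<rho> * (2 * (b \<bullet> b))" for b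
  proof -
    define f where "f = (\<lambda>h. \<gamma> * ln (n t (x + h *\<^sub>R b)) - \<psi> ((x + h *\<^sub>R b) \<bullet> (x + h *\<^sub>R b)))"
    define f' where "f' = (\<lambda>h. \<gamma> / n t (x + h *\<^sub>R b) * (b \<bullet> G t (x + h *\<^sub>R b))
       - \<psi>' ((x + h *\<^sub>R b) \<bullet> (x + h *\<^sub>R b)) * (2 * (b \<bullet> (x + h *\<^sub>R b))))"
    have 1: "\<forall>\<^sub>F h in nhds 0. (f has_real_derivative f' h) (at h)"
      using line[of b]
    proof eventually_elim
      case (elim h)
      show ?case unfolding f_def f'_def
        by (intro DERIV_diff radial_line_derivative d\<psi> line_derivative[OF t0, where \<phi> = "\<lambda>z. \<gamma> * ln z" and \<phi>' = "\<lambda>z. \<gamma> / z"])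
          (use elim in \<open>auto intro!: derivative_eq_intros\<close>)
    qed
    have 2: "(f' has_real_derivative (- \<gamma> / N\<^sup>2 * (b \<bullet> G t x)\<^sup>2 + \<gamma> / N * (b \<bullet> A t x b))
        - (\<psi>'' * (4 * (b \<bullet> x)\<^sup>2) + \<psi>' \<rho> * (2 * (b \<bullet> b)))) (at 0)"
      unfolding f'_def N_def \<rho>_def
      by (intro DERIV_diff radial_line_second_derivative d\<psi>'[unfolded \<rho>_def] line_second_derivative[OF t0, where \<phi>' = "\<lambda>z. \<gamma> / z" and \<phi>'' = "\<lambda>z. - \<gamma> / z\<^sup>2"])
        (auto intro!: derivative_eq_intros simp: power2_eq_square)
    have 3: "\<forall>\<^sub>F h in nhds 0. f h \<le> f 0"
      using line[of b]
    proof eventually_elim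
      case (elim h)
      define y where "y = x + h *\<^sub>R b"
      have y: "1 < y \<bullet> y" "\<nu> * ln (y \<bullet> y) < 1" using elim by (auto simp: y_def)
      have "Z (t, y) \<le> Z (t, x)" using y st by (intro mx) (auto simp: S_def)
      then have "n t y powr \<gamma> * (1 - \<nu> * ln (y \<bullet> y)) powr k / (y \<bullet> y) * ((t - s) / (K * (t - s) + a))
        \<le> n t x powr \<gamma> * (1 - \<nu> * ln (x \<bullet> x)) powr k / (x \<bullet> x) * ((t - s) / (K * (t - s) + a))"
        by (simp add: Z_def mult_ac)
      moreover have "(t - s) / (K * (t - s) + a) > 0" using st den[of "t - s"] by simp
      ultimately have le: "n t y powr \<gamma> * (1 - \<nu> * ln (y \<bullet> y)) powr k / (y \<bullet> y)
        \<le> n t x powr \<gamma> * (1 - \<nu> * ln (x \<bullet> x)) powr k / (x \<bullet> x)"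
        by (simp only: mult_le_cancel_right_pos)
      have F: "exp (\<gamma> * ln (n t z) - \<psi> (z \<bullet> z)) = n t z powr \<gamma> * (1 - \<nu> * ln (z \<bullet> z)) powr k / (z \<bullet> z)"
        if "1 < z \<bullet> z" "\<nu> * ln (z \<bullet> z) < 1" for z
      proof -
        have "exp (\<gamma> * ln (n t z) - \<psi> (z \<bullet> z)) = exp (\<gamma> * ln (n t z)) * exp (k * ln (1 - \<nu> * ln (z \<bullet> z))) / exp (ln (z \<bullet> z))"
          by (simp add: \<psi>_def exp_diff exp_add right_diff_distrib divide_simps)
        moreover have "exp (ln (z \<bullet> z)) = z \<bullet> z" using that by (intro exp_ln) linarith
        moreover have "n t z > 0" using pos t0 by simp
        ultimately show ?thesis using that by (simp add: powr_def)
      qed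
      have "exp (f h) \<le> exp (f 0)"
        using le F[OF y] F[of x] \<rho>1 e0 by (simp add: f_def y_def \<rho>_def)
      then show ?case by simp
    qed
    show "\<gamma> / N * (b \<bullet> G t x) = \<psi>' \<rho> * (2 * (b \<bullet> x))"
      using second_derivative_test_max(1)[OF 1 2 3] by (simp add: f'_def N_def \<rho>_def)
    show "- \<gamma> / N\<^sup>2 * (b \<bullet> G t x)\<^sup>2 + \<gamma> / N * (b \<bullet> A t x b) \<le> \<psi>'' * (4 * (b \<bullet> x)\<^sup>2) + \<psi>' \<rho> * (2 * (b \<bullet> b))"
      using second_derivative_test_max(2)[OF 1 2 3] by simp
  qed
  define trA where "trA = (\<Sum>b\<in>Basis. A t x b \<bullet> b)"
  define GG where "GG = G t x \<bullet> G t x"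
  have grad: "\<gamma>\<^sup>2 / N\<^sup>2 * GG = 4 * \<rho> * (\<psi>' \<rho>)\<^sup>2"
  proof -
    have "\<gamma>\<^sup>2 / N\<^sup>2 * GG = (\<Sum>b\<in>Basis. \<gamma>\<^sup>2 / N\<^sup>2 * (b \<bullet> G t x)\<^sup>2)"
      by (simp only: GG_def sum_Basis_inner_sq flip: sum_distrib_left)
    also have "\<dots> = (\<Sum>b\<in>Basis. (\<gamma> / N * (b \<bullet> G t x))\<^sup>2)"
      by (simp only: power_mult_distrib power_divide)
    also have "\<dots> = (\<Sum>b\<in>Basis. 4 * (\<psi>' \<rho>)\<^sup>2 * (b \<bullet> x)\<^sup>2)"
      unfolding spatial(1) by (simp add: power_mult_distrib mult_ac)
    also have "\<dots> = 4 * (\<psi>' \<rho>)\<^sup>2 * \<rho>"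
      by (simp only: sum_Basis_inner_sq \<rho>_def flip: sum_distrib_left)
    finally show ?thesis by simp
  qed
  have lap: "- \<gamma> / N\<^sup>2 * GG + \<gamma> / N * trA \<le> 4 * \<rho> * \<psi>'' + 2 * DIM('a) * \<psi>' \<rho>"
  proof -
    have "- \<gamma> / N\<^sup>2 * GG + \<gamma> / N * trA = (\<Sum>b\<in>Basis. - \<gamma> / N\<^sup>2 * (b \<bullet> G t x)\<^sup>2 + \<gamma> / N * (b \<bullet> A t x b))"
      by (simp only: sum.distrib GG_def trA_def inner_commute[of "A t x _"] sum_Basis_inner_sq flip: sum_distrib_left)
    also have "\<dots> \<le> (\<Sum>b\<in>(Basis::'a set). \<psi>'' * (4 * (b \<bullet> x)\<^sup>2) + \<psi>' \<rho> * (2 * (b \<bullet> b)))"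
      by (rule sum_mono) (rule spatial)
    also have "\<dots> = (\<Sum>b\<in>(Basis::'a set). \<psi>'' * (4 * (b \<bullet> x)\<^sup>2) + \<psi>' \<rho> * 2)"
      by (rule sum.cong) (auto simp: inner_Basis)
    also have "\<dots> = \<psi>'' * (4 * (x \<bullet> x)) + \<psi>' \<rho> * 2 * DIM('a)"
      by (simp only: sum.distrib sum_Basis_inner_sq sum_constant flip: sum_distrib_left) simp
    finally show ?thesis by (simp add: \<rho>_def mult_ac)
  qed
  have time: "\<gamma> / N * (- \<gamma> * (\<gamma> * N powr (\<gamma> - 1) * GG + N powr \<gamma> * trA)) + (1 / (t - s) - K / (K * (t - s) + a)) \<ge> 0"
  proof (rule left_max_derivative_nonneg)
    define f where "f = (\<lambda>r. \<gamma> * ln (n r x) + (ln (r - s) - ln (K * (r - s) + a)))"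
    show "(f has_real_derivative \<gamma> / N * (- \<gamma> * (\<gamma> * N powr (\<gamma> - 1) * GG + N powr \<gamma> * trA))
      + (1 / (t - s) - K / (K * (t - s) + a))) (at t)"
      unfolding f_def N_def GG_def trA_def
      by (intro DERIV_add time_derivative[OF t0, where \<phi> = "\<lambda>z. \<gamma> * ln z" and \<phi>' = "\<lambda>z. \<gamma> / z"])
        (use st den[of "t - s"] in \<open>auto intro!: derivative_eq_intros\<close>)
    show "s < t" by (rule st)
    fix r assume r: "s < r" "r < t"
    have "Z (r, x) \<le> Z (t, x)" using r tx by (intro mx) (auto simp: S_def)
    then have "n r x powr \<gamma> * (r - s) / (K * (r - s) + a) * ((1 - \<nu> * ln \<rho>) powr k / \<rho>)
        \<le> n t x powr \<gamma> * (t - s) / (K * (t - s) + a) * ((1 - \<nu> * ln \<rho>) powr k / \<rho>)"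
      by (simp add: Z_def \<rho>_def mult_ac)
    moreover have "(1 - \<nu> * ln \<rho>) powr k / \<rho> > 0" using e0 \<rho>1 by simp
    ultimately have le: "n r x powr \<gamma> * (r - s) / (K * (r - s) + a) \<le> n t x powr \<gamma> * (t - s) / (K * (t - s) + a)"
      by (simp only: mult_le_cancel_right_pos)
    have "exp (f q) = n q x powr \<gamma> * (q - s) / (K * (q - s) + a)" if "q > s" for q
      using that den[of "q - s"] pos[of q x] s by (simp add: f_def exp_add exp_diff powr_def)
    from this[of r] this[of t] le r have "exp (f r) \<le> exp (f t)" by simp
    then show "f r \<le> f t" by simp
  qed
  define U where "U = N powr \<gamma>"
  have U: "N powr (\<gamma> - 1) = U / N" using N by (simp add: U_def powr_diff)
  have Upos: "U > 0" using N by (simp add: U_def)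
  define mm where "mm = m \<rho>"
  have mm: "mm \<ge> 0" using kpos \<nu> e0 by (simp add: mm_def m_def)
  \<comment> \<open>The terms in \<open>mm\<^sup>2\<close> cancel because |\<gamma>| / k = 1 +
    \<gamma>, the linear term has the right sign by the third part of \<open>gamma_bound\<close>,
    and the constant term is -1/a.\<close>
  have rate: "- \<gamma> * (4 * \<rho> * \<psi>'' + 2 * DIM('a) * \<psi>' \<rho>) - (1 + \<gamma>) * (4 * \<rho> * (\<psi>' \<rho>)\<^sup>2) \<le> - 1 / (a * \<rho>)"
  proof -
    have k1: "- \<gamma> * (mm\<^sup>2 / k) = (1 + \<gamma>) * mm\<^sup>2" using g1 gamma by (simp add: k)
    let ?X = "- \<gamma> * (4 * \<rho> * \<psi>'' + 2 * DIM('a) * \<psi>' \<rho>) - (1 + \<gamma>) * (4 * \<rho> * (\<psi>' \<rho>)\<^sup>2)"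
    have "\<rho> * (- \<gamma> * (4 * \<rho> * \<psi>'' + 2 * DIM('a) * \<psi>' \<rho>) - (1 + \<gamma>) * (4 * \<rho> * (\<psi>' \<rho>)\<^sup>2))
        = - \<gamma> * (4 * (mm\<^sup>2 / k - (1 + mm)) + 2 * DIM('a) * (1 + mm)) - (1 + \<gamma>) * (4 * (1 + mm)\<^sup>2)"
      using \<rho>1 unfolding \<psi>''_def \<psi>'_def mm_def[symmetric] by (simp add: field_simps power2_eq_square)
    also have "\<dots> = 4 * (- \<gamma> * (mm\<^sup>2 / k)) + \<gamma> * 4 * (1 + mm) - \<gamma> * 2 * DIM('a) * (1 + mm) - (1 + \<gamma>) * (4 * (1 + mm)\<^sup>2)"
      by (simp add: algebra_simps)
    also have "\<dots> = - (4 + 2 * DIM('a) * \<gamma>) + mm * ((2 * DIM('a) + 4) * - \<gamma> - 8)"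
      unfolding k1 by (simp add: algebra_simps power2_eq_square)
    also have "\<dots> \<le> - (4 + 2 * DIM('a) * \<gamma>)"
      using gamma_bound(3) mm by (simp add: mult_nonneg_nonpos)
    also have "\<dots> = - 1 / a" by (simp add: a)
    finally have "?X * \<rho> \<le> - 1 / a" by (simp only: mult.commute)
    then have "?X \<le> - 1 / a / \<rho>" using \<rho>1 by (simp only: pos_le_divide_eq)
    then show ?thesis by simp
  qed
  \<comment> \<open>This is the equation in logarithmic form, \<partial>_t ln u = u (|\<gamma>|
    \<Delta> ln u - (1 + \<gamma>) |\<nabla> ln u|^2).\<close>
  have "\<gamma> / N * (- \<gamma> * (\<gamma> * N powr (\<gamma> - 1) * GG + N powr \<gamma> * trA))
      = U * (- \<gamma> * (- \<gamma> / N\<^sup>2 * GG + \<gamma> / N * trA) - (1 + \<gamma>) * (\<gamma>\<^sup>2 / N\<^sup>2 * GG))"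
    unfolding U U_def[symmetric] by (simp add: divide_inverse power2_eq_square algebra_simps)
  also have "\<dots> \<le> U * (- \<gamma> * (4 * \<rho> * \<psi>'' + 2 * DIM('a) * \<psi>' \<rho>) - (1 + \<gamma>) * (4 * \<rho> * (\<psi>' \<rho>)\<^sup>2))"
    unfolding grad using gamma Upos by (intro mult_left_mono[of _ _ U] diff_right_mono mult_left_mono[OF lap]) auto
  also have "\<dots> \<le> U * (- 1 / (a * \<rho>))"
    by (rule mult_left_mono[OF rate]) (use Upos in simp)
  also have "\<dots> < (K + a / (t - s)) * \<rho> * (- 1 / (a * \<rho>))"
    using u apos \<rho>1 by (intro mult_strict_right_mono_neg) (auto simp: U_def N_def)
  also have "\<dots> = - (K + a / (t - s)) / a"
    using \<rho>1 apos by (simp add: field_simps)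
  finally have "(K + a / (t - s)) / a < 1 / (t - s) - K / (K * (t - s) + a)"
    using time by linarith
  \<comment> \<open>Since 1/\<tau> - K/q = a / (\<tau> q), the last inequality becomes q^2 < a^2,
    against q > a.\<close>
  define \<tau> q where "\<tau> = t - s" and "q = K * (t - s) + a"
  have \<tau>: "\<tau> > 0" using st by (simp add: \<tau>_def)
  have q: "q > a" using K st by (simp add: q_def)
  have "1 / \<tau> - K / q = a / (\<tau> * q)"
    using \<tau> q apos by (simp add: diff_divide_eq_iff divide_diff_eq_iff) (simp add: q_def \<tau>_def mult.commute)
  moreover have "K + a / \<tau> = q / \<tau>" using \<tau> by (simp add: q_def \<tau>_def add_divide_distrib)
  ultimately have "q / \<tau> / a < a / (\<tau> * q)"
    using \<open>(K + a / (t - s)) / a < _\<close> by (simp add: \<tau>_def q_def)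
  then have "q / \<tau> / a * (\<tau> * a * q) < a / (\<tau> * q) * (\<tau> * a * q)"
    using \<tau> q apos by (intro mult_strict_right_mono) auto
  then have "q * q < a * a" using \<tau> q apos by simp
  then show False using q apos mult_strict_mono[of a q a q] by simp
qed

text \<open>The barrier starts at \<open>s0 / 2\<close>, before the interval, so a/(t - s) stays
  bounded on it. For a fixed point outside the unit ball the logarithmic factor tends to 1 as \<nu>
  tends to 0; inside the unit ball compactness suffices.\<close>

lemma quadratic_growth:
  assumes s0: "0 < s0"
  shows "\<exists>C>0. \<forall>t\<in>{s0..T}. \<forall>x. n t x powr \<gamma> \<le> C * (1 + x \<bullet> x)"
proof -
  define s where "s = s0 / 2"
  have s: "0 < s" "s < s0" using s0 by (auto simp: s_def)
  define k where "k = - \<gamma> / (1 + \<gamma>)"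
  define a where "a = 1 / (4 + 2 * real DIM('a) * \<gamma>)"
  have apos: "a > 0" using gamma_bound by (simp add: a_def)
  have "compact ((\<lambda>z. n (fst z) (snd z) powr \<gamma>) ` ({s..T} \<times> cball 0 1))"
    by (intro compact_continuous_image continuous_on_subset[OF continuous_on_powr_n] compact_Times) (use s in auto)
  then have "bdd_above ((\<lambda>z. n (fst z) (snd z) powr \<gamma>) ` ({s..T} \<times> cball 0 1))"
    by (intro bounded_imp_bdd_above compact_imp_bounded)
  then obtain K0 where K0: "\<And>t x. t \<in> {s..T} \<Longrightarrow> norm x \<le> 1 \<Longrightarrow> n t x powr \<gamma> \<le> K0"
    unfolding bdd_above_def by fastforce
  define K where "K = max 1 K0"
  define C where "C = K + a / (s0 - s)"
  have K: "K \<ge> 1" "K0 \<le> K" by (auto simp: K_def)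
  have C: "C > 0" "K \<le> C" using K apos s by (auto simp: C_def add_pos_pos)
  have "n t x powr \<gamma> \<le> C * (1 + x \<bullet> x)" if t: "t \<in> {s0..T}" for t x
  proof (cases "x \<bullet> x \<ge> 1")
    case False
    then have "norm x \<le> 1" by (simp add: norm_eq_sqrt_inner)
    then have "n t x powr \<gamma> \<le> C * 1" using K0[of t x] t s K C by auto
    also have "\<dots> \<le> C * (1 + x \<bullet> x)" using C by (intro mult_left_mono) auto
    finally show ?thesis .
  next
    case True
    define l where "l = ln (x \<bullet> x)"
    have "((\<lambda>\<nu>. n t x powr \<gamma> * (1 - \<nu> * l) powr k) \<longlongrightarrow> n t x powr \<gamma> * (1 - 0 * l) powr k) (at_right 0)"
      by (intro tendsto_intros) auto
    moreover have "\<forall>\<^sub>F \<nu> in at_right 0. n t x powr \<gamma> * (1 - \<nu> * l) powr k \<le> (K + a / (t - s)) * (x \<bullet> x)"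
    proof -
      have "((\<lambda>\<nu>. \<nu> * l) \<longlongrightarrow> 0 * l) (at_right 0)" by (intro tendsto_intros)
      then have "\<forall>\<^sub>F \<nu> in at_right 0. \<nu> * l < 1" by (rule order_tendstoD) simp
      moreover have "\<forall>\<^sub>F \<nu> in at_right 0. (0::real) < \<nu>" by (simp add: eventually_at_right_less)
      ultimately show ?thesis
      proof eventually_elim
        case (elim \<nu>)
        have sph: "n t' y powr \<gamma> \<le> K" if "s \<le> t'" "t' \<le> T" "y \<bullet> y = 1" for t' y
          using K0[of t' y] K that by (auto simp: norm_eq_sqrt_inner)
        show ?case
          unfolding l_def
          by (rule log_barrier[OF s(1) _ _ sph k_def a_def]) (use K elim t s True in \<open>auto simp: l_def\<close>)
      qed
    qed
    ultimately have "n t x powr \<gamma> * (1 - 0 * l) powr k \<le> (K + a / (t - s)) * (x \<bullet> x)"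
      by (intro tendsto_upperbound) auto
    also have "\<dots> \<le> C * (x \<bullet> x)"
      using t s apos unfolding C_def by (intro mult_right_mono add_left_mono divide_left_mono) auto
    also have "\<dots> \<le> C * (1 + x \<bullet> x)" using C by (intro mult_left_mono) auto
    finally show ?thesis by simp
  qed
  then show ?thesis using C by blast
qed

end

section \<open>Doubling of variables\<close>

context fast_diffusion
begin

section \<open>The square root of the pressure as the unknown\<close>

definition w :: "real \<Rightarrow> 'a \<Rightarrow> real" where
  "w t x = n t x powr (\<gamma> / 2)"

definition grad_w :: "real \<Rightarrow> 'a \<Rightarrow> 'a" where
  "grad_w t x = (\<gamma> / 2 * n t x powr (\<gamma> / 2 - 1)) *\<^sub>R G t x"

definition hess_w :: "real \<Rightarrow> 'a \<Rightarrow> 'a \<Rightarrow> real" where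
  "hess_w t x \<xi> = \<gamma> / 2 * (\<gamma> / 2 - 1) * n t x powr (\<gamma> / 2 - 2) * (\<xi> \<bullet> G t x)\<^sup>2
     + \<gamma> / 2 * n t x powr (\<gamma> / 2 - 1) * (\<xi> \<bullet> A t x \<xi>)"

lemma w_pos: "t > 0 \<Longrightarrow> w t x > 0"
  using pos[of t x] by (simp add: w_def)

lemma w_sq: "(w t x)\<^sup>2 = n t x powr \<gamma>"
  by (simp add: w_def power2_eq_square flip: powr_add)

lemma has_derivative_w:
  assumes "t > 0"
  shows "(w t has_derivative (\<lambda>h. h \<bullet> grad_w t x)) (at x)"
  using has_derivative_powr_const[OF deriv_n[OF assms, of x] pos[OF assms], of "\<gamma> / 2"]
  unfolding w_def[abs_def] grad_w_def by (simp add: algebra_simps)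

lemma continuous_on_w: "continuous_on ({0<..} \<times> UNIV) (\<lambda>z. w (fst z) (snd z))"
  unfolding w_def by (rule continuous_on_powr_n)

lemma continuous_on_grad_w: "continuous_on ({0<..} \<times> UNIV) (\<lambda>z. grad_w (fst z) (snd z))"
  unfolding grad_w_def
  by (intro continuous_intros continuous_on_powr_n) (use cont_G in \<open>simp add: split_def\<close>)

lemma w_line:
  assumes "t > 0"
  shows "((\<lambda>h. w t (x + h *\<^sub>R \<xi>)) has_real_derivative \<xi> \<bullet> grad_w t (x + h *\<^sub>R \<xi>)) (at h)"
proof -
  have "((\<lambda>h. n t (x + h *\<^sub>R \<xi>) powr (\<gamma> / 2)) has_real_derivative
      (\<gamma> / 2 * n t (x + h *\<^sub>R \<xi>) powr (\<gamma> / 2 - 1)) * (\<xi> \<bullet> G t (x + h *\<^sub>R \<xi>))) (at h)"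
    using has_real_derivative_powr by (rule line_derivative[OF assms])
  then show ?thesis by (simp add: w_def grad_w_def)
qed

lemma w_line2:
  assumes "t > 0"
  shows "((\<lambda>h. \<xi> \<bullet> grad_w t (x + h *\<^sub>R \<xi>)) has_real_derivative hess_w t x \<xi>) (at 0)"
proof -
  have "((\<lambda>h. \<gamma> / 2 * n t (x + h *\<^sub>R \<xi>) powr (\<gamma> / 2 - 1) * (\<xi> \<bullet> G t (x + h *\<^sub>R \<xi>))) has_real_derivative
      (\<gamma> / 2 * (\<gamma> / 2 - 1) * n t x powr (\<gamma> / 2 - 2)) * (\<xi> \<bullet> G t x)\<^sup>2
      + (\<gamma> / 2 * n t x powr (\<gamma> / 2 - 1)) * (\<xi> \<bullet> A t x \<xi>)) (at 0)"
  proof (rule line_second_derivative[OF assms])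
    fix z :: real assume "z > 0"
    from DERIV_cmult[OF has_real_derivative_powr[OF this, of "\<gamma> / 2 - 1"], of "\<gamma> / 2"]
    show "((\<lambda>z. \<gamma> / 2 * z powr (\<gamma> / 2 - 1)) has_real_derivative \<gamma> / 2 * (\<gamma> / 2 - 1) * z powr (\<gamma> / 2 - 2)) (at z)"
      by (simp add: mult.assoc)
  qed
  then show ?thesis by (simp add: hess_w_def grad_w_def)
qed

lemma hess_w_scale: "t > 0 \<Longrightarrow> hess_w t x (c *\<^sub>R \<xi>) = c\<^sup>2 * hess_w t x \<xi>"
proof -
  assume t: "t > 0"
  have "linear (A t x)" using deriv_G[OF t] has_derivative_linear by blast
  then have "A t x (c *\<^sub>R \<xi>) = c *\<^sub>R A t x \<xi>" by (rule linear_cmul)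
  then show ?thesis by (simp add: hess_w_def power_mult_distrib algebra_simps power2_eq_square)
qed

lemma w_time:
  assumes t: "t > 0"
  shows "((\<lambda>s. w s x) has_real_derivative
    - \<gamma> * (w t x)\<^sup>2 * (\<Sum>b\<in>Basis. hess_w t x b) - (2 + \<gamma>) * w t x * (grad_w t x \<bullet> grad_w t x)) (at t)"
proof -
  define N where "N = n t x"
  \<comment> \<open>Writing every power of the density through \<open>B\<close> and the inverse of
    \<open>N\<close> turns the claim into a polynomial identity.\<close>
  define B where "B = N powr (\<gamma> / 2)"
  define trA where "trA = (\<Sum>b\<in>Basis. A t x b \<bullet> b)"
  define GG where "GG = G t x \<bullet> G t x"
  have N: "N > 0" using pos[OF t] by (simp add: N_def)
  define i where "i = inverse N"
  have P1: "N powr (\<gamma> / 2 - 1) = B * inverse N"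
    unfolding powr_diff B_def using N by (simp only: powr_one divide_inverse[of _ N])
  have P2: "N powr (\<gamma> / 2 - 2) = B * inverse N * inverse N"
  proof -
    have "N powr 2 = N * N" using N by (simp add: power2_eq_square)
    then show ?thesis unfolding powr_diff B_def using N by (simp add: field_simps)
  qed
  have P3: "N powr \<gamma> = B * B" by (simp add: B_def flip: powr_add)
  have P4: "N powr (\<gamma> - 1) = B * B * inverse N"
    unfolding powr_diff P3 using N by (simp only: powr_one divide_inverse[of _ N])
  have L: "(\<Sum>b\<in>Basis. hess_w t x b) = \<gamma> / 2 * (\<gamma> / 2 - 1) * (B * inverse N * inverse N) * GG + \<gamma> / 2 * (B * inverse N) * trA"
    unfolding hess_w_def N_def[symmetric] P1 P2
    by (simp only: sum.distrib GG_def trA_def inner_commute[of "A t x _"] sum_Basis_inner_sq flip: sum_distrib_left)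
  have W: "w t x = B" by (simp add: w_def B_def N_def)
  have PP: "grad_w t x \<bullet> grad_w t x = (\<gamma> / 2 * (B * inverse N))\<^sup>2 * GG"
    by (simp add: grad_w_def GG_def N_def[symmetric] P1 power2_eq_square)
  have "((\<lambda>s. n s x powr (\<gamma> / 2)) has_real_derivative (\<gamma> / 2 * N powr (\<gamma> / 2 - 1)) *
     (- \<gamma> * (\<gamma> * N powr (\<gamma> - 1) * GG + N powr \<gamma> * trA))) (at t)"
    unfolding N_def GG_def trA_def using has_real_derivative_powr by (rule time_derivative[OF t])
  moreover have "(\<gamma> / 2 * N powr (\<gamma> / 2 - 1)) * (- \<gamma> * (\<gamma> * N powr (\<gamma> - 1) * GG + N powr \<gamma> * trA))
     = - \<gamma> * (w t x)\<^sup>2 * (\<Sum>b\<in>Basis. hess_w t x b) - (2 + \<gamma>) * w t x * (grad_w t x \<bullet> grad_w t x)"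
    unfolding L W PP P1 P3 P4 i_def[symmetric] by (simp add: power2_eq_square field_simps)
  ultimately show ?thesis by (simp add: w_def)
qed

text \<open>A qualitative bound with an uncontrolled constant. It keeps the squared difference
  quotient below \<open>\<Lambda>\<^sup>2\<close>, so a weight that blows up must win near the
  boundary of its domain.\<close>

lemma w_Lipschitz:
  assumes s: "0 < s"
  shows "\<exists>\<Lambda>>0. \<forall>t\<in>{s..T}. \<forall>x\<in>cball 0 R. \<forall>y\<in>cball 0 R. \<bar>w t x - w t y\<bar> \<le> \<Lambda> * norm (x - y)"
proof -
  have "compact ((\<lambda>z. grad_w (fst z) (snd z)) ` ({s..T} \<times> cball 0 R))"
    by (intro compact_continuous_image continuous_on_subset[OF continuous_on_grad_w] compact_Times) (use s in auto)
  then have "bounded ((\<lambda>z. grad_w (fst z) (snd z)) ` ({s..T} \<times> cball 0 R))"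
    by (rule compact_imp_bounded)
  then obtain \<Lambda> where "\<Lambda> > 0" and im: "\<And>v. v \<in> (\<lambda>z. grad_w (fst z) (snd z)) ` ({s..T} \<times> cball 0 R) \<Longrightarrow> norm v \<le> \<Lambda>"
    unfolding bounded_pos by blast
  have \<Lambda>: "\<Lambda> > 0" "\<And>t x. t \<in> {s..T} \<Longrightarrow> x \<in> cball 0 R \<Longrightarrow> norm (grad_w t x) \<le> \<Lambda>"
  proof -
    fix t and x :: 'a assume "t \<in> {s..T}" "x \<in> cball 0 R"
    then show "norm (grad_w t x) \<le> \<Lambda>" by (intro im image_eqI[of _ _ "(t, x)"]) auto
  qed fact
  have "\<bar>w t x - w t y\<bar> \<le> \<Lambda> * norm (x - y)" if t: "t \<in> {s..T}" and xy: "x \<in> cball 0 R" "y \<in> cball 0 R" for t x y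
  proof -
    have "norm (w t x - w t y) \<le> \<Lambda> * norm (x - y)"
    proof (rule differentiable_bound[where S = "cball 0 R" and f' = "\<lambda>z h. h \<bullet> grad_w t z"])
      show "convex (cball (0::'a) R)" by (rule convex_cball)
      show "x \<in> cball 0 R" "y \<in> cball 0 R" by (fact xy)+
      fix z assume z: "z \<in> cball (0::'a) R"
      show "(w t has_derivative (\<lambda>h. h \<bullet> grad_w t z)) (at z within cball 0 R)"
        by (rule has_derivative_at_withinI[OF has_derivative_w]) (use t s in auto)
      show "onorm (\<lambda>h. h \<bullet> grad_w t z) \<le> \<Lambda>"
      proof (rule onorm_le)
        fix h :: 'a
        have "norm (h \<bullet> grad_w t z) \<le> norm h * norm (grad_w t z)" by (simp add: Cauchy_Schwarz_ineq2)
        also have "\<dots> \<le> norm h * \<Lambda>" using \<Lambda>(2)[OF t z] by (simp add: mult_left_mono)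
        finally show "norm (h \<bullet> grad_w t z) \<le> \<Lambda> * norm h" by (simp add: mult.commute)
      qed
    qed
    then show ?thesis by simp
  qed
  then show ?thesis using \<Lambda>(1) by (intro exI[of _ \<Lambda>] conjI ballI)
qed

text \<open>The two points move simultaneously with independent velocities, and this freedom couples
  the two Hessians. The weight \<open>M\<close> need be differentiable only on \<open>I\<close>,
  since it blows up where the cutoff ends.\<close>

lemma doubled_line_test:
  assumes t: "t > 0" and I: "open I" "x \<bullet> x \<in> I"
    and M: "\<And>r. r \<in> I \<Longrightarrow> (M has_real_derivative M' r) (at r)"
    and M': "(M' has_real_derivative M'') (at (x \<bullet> x))"
    and mx: "\<forall>\<^sub>F h in nhds 0.
      (w t (x + h *\<^sub>R \<xi>) - w t (y + h *\<^sub>R \<eta>))\<^sup>2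
        - M ((x + h *\<^sub>R \<xi>) \<bullet> (x + h *\<^sub>R \<xi>)) * (((x - y) + h *\<^sub>R (\<xi> - \<eta>)) \<bullet> ((x - y) + h *\<^sub>R (\<xi> - \<eta>)))
      \<le> (w t x - w t y)\<^sup>2 - M (x \<bullet> x) * ((x - y) \<bullet> (x - y))"
  shows "2 * (w t x - w t y) * (\<xi> \<bullet> grad_w t x - \<eta> \<bullet> grad_w t y)
      = M' (x \<bullet> x) * (2 * (\<xi> \<bullet> x)) * ((x - y) \<bullet> (x - y)) + M (x \<bullet> x) * (2 * ((\<xi> - \<eta>) \<bullet> (x - y)))"
    and "2 * (\<xi> \<bullet> grad_w t x - \<eta> \<bullet> grad_w t y)\<^sup>2 + 2 * (w t x - w t y) * (hess_w t x \<xi> - hess_w t y \<eta>)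
      \<le> (M'' * (4 * (\<xi> \<bullet> x)\<^sup>2) + M' (x \<bullet> x) * (2 * (\<xi> \<bullet> \<xi>))) * ((x - y) \<bullet> (x - y))
        + 2 * (M' (x \<bullet> x) * (2 * (\<xi> \<bullet> x)) * (2 * ((\<xi> - \<eta>) \<bullet> (x - y))))
        + M (x \<bullet> x) * (2 * ((\<xi> - \<eta>) \<bullet> (\<xi> - \<eta>)))"
proof -
  define v \<zeta> where "v = x - y" and "\<zeta> = \<xi> - \<eta>"
  define D where "D = (\<lambda>h. w t (x + h *\<^sub>R \<xi>) - w t (y + h *\<^sub>R \<eta>))"
  define D' where "D' = (\<lambda>h. \<xi> \<bullet> grad_w t (x + h *\<^sub>R \<xi>) - \<eta> \<bullet> grad_w t (y + h *\<^sub>R \<eta>))"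
  define m where "m = (\<lambda>h::real. M ((x + h *\<^sub>R \<xi>) \<bullet> (x + h *\<^sub>R \<xi>)))"
  define m' where "m' = (\<lambda>h::real. M' ((x + h *\<^sub>R \<xi>) \<bullet> (x + h *\<^sub>R \<xi>)) * (2 * (\<xi> \<bullet> (x + h *\<^sub>R \<xi>))))"
  define R where "R = (\<lambda>h::real. (v + h *\<^sub>R \<zeta>) \<bullet> (v + h *\<^sub>R \<zeta>))"
  define R' where "R' = (\<lambda>h::real. 2 * (\<zeta> \<bullet> (v + h *\<^sub>R \<zeta>)))"
  define f where "f = (\<lambda>h. (D h)\<^sup>2 - m h * R h)"
  define f' where "f' = (\<lambda>h. 2 * D h * D' h - (m' h * R h + m h * R' h))"
  have line: "\<forall>\<^sub>F h in nhds 0. (x + h *\<^sub>R \<xi>) \<bullet> (x + h *\<^sub>R \<xi>) \<in> I"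
  proof -
    have "((\<lambda>h. (x + h *\<^sub>R \<xi>) \<bullet> (x + h *\<^sub>R \<xi>)) \<longlongrightarrow> (x + 0 *\<^sub>R \<xi>) \<bullet> (x + 0 *\<^sub>R \<xi>)) (nhds 0)"
      by (intro tendsto_intros filterlim_ident)
    then show ?thesis using I by (intro topological_tendstoD) auto
  qed
  have dD: "(D has_real_derivative D' h) (at h)" for h
    unfolding D_def D'_def by (intro DERIV_diff w_line t)
  have dD': "(D' has_real_derivative (hess_w t x \<xi> - hess_w t y \<eta>)) (at 0)"
    unfolding D'_def by (intro DERIV_diff w_line2 t)
  have dR: "(R has_real_derivative R' h) (at h)" for h
    unfolding R_def R'_def by (rule norm_sq_line_derivative)
  have dR': "(R' has_real_derivative 2 * (\<zeta> \<bullet> \<zeta>)) (at 0)"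
    unfolding R'_def by (auto simp: inner_add_right intro!: derivative_eq_intros)
  have dm: "(m has_real_derivative m' h) (at h)" if "(x + h *\<^sub>R \<xi>) \<bullet> (x + h *\<^sub>R \<xi>) \<in> I" for h
    unfolding m_def m'_def by (intro radial_line_derivative M that)
  have dm': "(m' has_real_derivative M'' * (4 * (\<xi> \<bullet> x)\<^sup>2) + M' (x \<bullet> x) * (2 * (\<xi> \<bullet> \<xi>))) (at 0)"
    unfolding m'_def by (intro radial_line_second_derivative M')
  have 1: "\<forall>\<^sub>F h in nhds 0. (f has_real_derivative f' h) (at h)"
    using line
  proof eventually_elim
    case (elim h)
    show ?case unfolding f_def f'_def
      using DERIV_diff[OF DERIV_power[OF dD[of h], of 2] DERIV_mult[OF dm[OF elim] dR[of h]]]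
      by (simp add: algebra_simps)
  qed
  have dm0: "(m has_real_derivative m' 0) (at 0)" using dm[of 0] I by simp
  have 2: "(f' has_real_derivative
      (2 * D' 0 * D' 0 + 2 * D 0 * (hess_w t x \<xi> - hess_w t y \<eta>))
      - ((M'' * (4 * (\<xi> \<bullet> x)\<^sup>2) + M' (x \<bullet> x) * (2 * (\<xi> \<bullet> \<xi>))) * R 0 + m' 0 * R' 0
         + (m' 0 * R' 0 + m 0 * (2 * (\<zeta> \<bullet> \<zeta>))))) (at 0)"
    unfolding f'_def
    using DERIV_diff[OF DERIV_mult[OF DERIV_cmult[OF dD[of 0], of 2] dD']
        DERIV_add[OF DERIV_mult[OF dm' dR[of 0]] DERIV_mult[OF dm0 dR']]]
    by (simp add: algebra_simps)
  have 3: "\<forall>\<^sub>F h in nhds 0. f h \<le> f 0"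
    using mx by eventually_elim (simp add: f_def D_def m_def R_def v_def \<zeta>_def)
  show "2 * (w t x - w t y) * (\<xi> \<bullet> grad_w t x - \<eta> \<bullet> grad_w t y)
      = M' (x \<bullet> x) * (2 * (\<xi> \<bullet> x)) * ((x - y) \<bullet> (x - y)) + M (x \<bullet> x) * (2 * ((\<xi> - \<eta>) \<bullet> (x - y)))"
    using second_derivative_test_max(1)[OF 1 2 3]
    by (simp add: f'_def D_def D'_def m_def m'_def R_def R'_def v_def \<zeta>_def)
  show "2 * (\<xi> \<bullet> grad_w t x - \<eta> \<bullet> grad_w t y)\<^sup>2 + 2 * (w t x - w t y) * (hess_w t x \<xi> - hess_w t y \<eta>)
      \<le> (M'' * (4 * (\<xi> \<bullet> x)\<^sup>2) + M' (x \<bullet> x) * (2 * (\<xi> \<bullet> \<xi>))) * ((x - y) \<bullet> (x - y))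
        + 2 * (M' (x \<bullet> x) * (2 * (\<xi> \<bullet> x)) * (2 * ((\<xi> - \<eta>) \<bullet> (x - y))))
        + M (x \<bullet> x) * (2 * ((\<xi> - \<eta>) \<bullet> (\<xi> - \<eta>)))"
    using second_derivative_test_max(2)[OF 1 2 3]
    by (simp add: D_def D'_def m_def m'_def R_def R'_def v_def \<zeta>_def power2_eq_square right_diff_distrib mult_ac)
qed

text \<open>The test vectors are weighted by \<open>w\<close>, the square root of the diffusion coefficient, so
  that the coupled Laplacians appear with their weights \<open>w\<^sup>2\<close>.\<close>

lemma doubled_spatial_inequality:
  assumes t: "t > 0" and I: "open I" "x \<bullet> x \<in> I"
    and M: "\<And>r. r \<in> I \<Longrightarrow> (M has_real_derivative M' r) (at r)"
    and M': "(M' has_real_derivative M'') (at (x \<bullet> x))"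
    and mx: "\<And>\<xi> \<eta>. \<forall>\<^sub>F h in nhds 0.
      (w t (x + h *\<^sub>R \<xi>) - w t (y + h *\<^sub>R \<eta>))\<^sup>2
        - M ((x + h *\<^sub>R \<xi>) \<bullet> (x + h *\<^sub>R \<xi>)) * (((x - y) + h *\<^sub>R (\<xi> - \<eta>)) \<bullet> ((x - y) + h *\<^sub>R (\<xi> - \<eta>)))
      \<le> (w t x - w t y)\<^sup>2 - M (x \<bullet> x) * ((x - y) \<bullet> (x - y))"
    and X: "X = w t x" and Y: "Y = w t y" and XY: "Y < X"
    and TX: "TX = (\<Sum>b\<in>Basis. hess_w t x b)" and TY: "TY = (\<Sum>b\<in>Basis. hess_w t y b)"
    and pp: "pp = grad_w t x \<bullet> grad_w t x" and qq: "qq = grad_w t y \<bullet> grad_w t y"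
    and r2: "r2 = (x - y) \<bullet> (x - y)" and j: "j = 2 * M' (x \<bullet> x) * (x \<bullet> (x - y))"
    and lap: "lap = 4 * (x \<bullet> x) * M'' + 2 * real DIM('a) * M' (x \<bullet> x)"
  shows "(X - Y) * ((- \<gamma> * X\<^sup>2 * TX - (2 + \<gamma>) * X * pp) - (- \<gamma> * Y\<^sup>2 * TY - (2 + \<gamma>) * Y * qq))
    \<le> - \<gamma> * (X\<^sup>2 * lap * r2 / 2 + 2 * X * (X - Y) * j + M (x \<bullet> x) * DIM('a) * (X - Y)\<^sup>2)
      - 2 * (M (x \<bullet> x))\<^sup>2 * r2 - 2 * X * r2 * M (x \<bullet> x) * j / (X - Y)"
proof -
  define D where "D = X - Y"
  have D: "D > 0" using XY by (simp add: D_def)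
  define v where "v = x - y"
  define \<rho> where "\<rho> = x \<bullet> x"
  define p where "p = grad_w t x"
  define q where "q = grad_w t y"
  have first: "D * (\<xi> \<bullet> p - \<eta> \<bullet> q) = M' \<rho> * (\<xi> \<bullet> x) * r2 + M \<rho> * ((\<xi> - \<eta>) \<bullet> v)" for \<xi> \<eta>
  proof -
    have "2 * D * (\<xi> \<bullet> p - \<eta> \<bullet> q) = M' \<rho> * (2 * (\<xi> \<bullet> x)) * r2 + M \<rho> * (2 * ((\<xi> - \<eta>) \<bullet> v))"
      unfolding D_def X Y p_def q_def r2 v_def \<rho>_def by (rule doubled_line_test(1)[OF t I M M' mx])
    then show ?thesis by simp
  qed
  \<comment> \<open>\<open>g\<close> is the gradient of the weight. Moving only y determines
    \<open>q\<close>; moving only x determines \<open>p\<close>, which differs from \<open>q\<close>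
    by a multiple of \<open>g\<close>.\<close>
  define g where "g = (2 * M' \<rho>) *\<^sub>R x"
  define k where "k = r2 / (2 * D)"
  define mv where "mv = M \<rho> / D"
  have Dk: "2 * D * k = r2" "D * mv = M \<rho>" using D by (simp_all add: k_def mv_def)
  have q: "q = mv *\<^sub>R v"
  proof (rule vector_eq_ldot[THEN iffD1], rule allI)
    fix \<eta>
    have "D * (\<eta> \<bullet> q) = D * (\<eta> \<bullet> mv *\<^sub>R v)" using first[of 0 \<eta>] Dk(2) by (simp flip: mult.assoc)
    then show "\<eta> \<bullet> q = \<eta> \<bullet> mv *\<^sub>R v" using D by simp
  qed
  have p: "p = q + k *\<^sub>R g"
  proof (rule vector_eq_ldot[THEN iffD1], rule allI)
    fix \<xi>
    have "D * (\<xi> \<bullet> p) = M' \<rho> * (\<xi> \<bullet> x) * r2 + M \<rho> * (\<xi> \<bullet> v)" using first[of \<xi> 0] by simp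
    also have "\<dots> = D * (\<xi> \<bullet> (q + k *\<^sub>R g))"
      unfolding q g_def Dk[symmetric] by (simp add: algebra_simps)
    finally show "\<xi> \<bullet> p = \<xi> \<bullet> (q + k *\<^sub>R g)" using D by simp
  qed
  have qv: "q \<bullet> q = mv * mv * r2" by (simp add: q r2 v_def)
  have vg: "q \<bullet> g = mv * j"
    by (simp add: q j g_def \<rho>_def v_def inner_commute algebra_simps)
  define gg where "gg = g \<bullet> g"
  have gg: "gg \<ge> 0" by (simp add: gg_def)
  have pq: "p \<bullet> q = qq + k * (mv * j)" and pp': "pp = qq + 2 * k * (mv * j) + k * k * gg"
    using vg by (simp_all add: p qq pp gg_def inner_add_left inner_add_right inner_commute
      p_def[symmetric] q_def[symmetric])
  have qq': "qq = mv * mv * r2" using qv by (simp add: qq q_def)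
  \<comment> \<open>Summed over the basis with velocities X b and Y b. Their difference is only D b,
    so the Hessian of the squared distance enters with the small factor
    \<open>D\<^sup>2\<close>.\<close>
  have second: "2 * (X\<^sup>2 * pp - 2 * X * Y * (p \<bullet> q) + Y\<^sup>2 * qq) + 2 * D * (X\<^sup>2 * TX - Y\<^sup>2 * TY)
    \<le> X\<^sup>2 * lap * r2 + 4 * X * D * j + 2 * M \<rho> * DIM('a) * D\<^sup>2"
  proof -
    have b: "2 * (X\<^sup>2 * (b \<bullet> p)\<^sup>2 - 2 * X * Y * ((b \<bullet> p) * (b \<bullet> q)) + Y\<^sup>2 * (b \<bullet> q)\<^sup>2)
        + 2 * D * (X\<^sup>2 * hess_w t x b - Y\<^sup>2 * hess_w t y b)
      \<le> X\<^sup>2 * (4 * M'' * (b \<bullet> x)\<^sup>2 + 2 * M' \<rho>) * r2 + 8 * X * D * M' \<rho> * ((b \<bullet> x) * (b \<bullet> v)) + 2 * M \<rho> * D\<^sup>2"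
      if "b \<in> Basis" for b
    proof -
      have bb: "b \<bullet> b = 1" using that by (simp add: inner_Basis)
      have e: "X *\<^sub>R b - Y *\<^sub>R b = D *\<^sub>R b" by (simp add: D_def scaleR_left_diff_distrib)
      show ?thesis
        using doubled_line_test(2)[OF t I M M' mx, of "X *\<^sub>R b" "Y *\<^sub>R b"]
        unfolding e hess_w_scale[OF t] p_def[symmetric] q_def[symmetric] v_def[symmetric] \<rho>_def[symmetric]
          r2[folded v_def, symmetric] X[symmetric] Y[symmetric] D_def[symmetric]
        by (simp add: bb power2_eq_square algebra_simps)
    qed
    have "2 * (X\<^sup>2 * pp - 2 * X * Y * (p \<bullet> q) + Y\<^sup>2 * qq) + 2 * D * (X\<^sup>2 * TX - Y\<^sup>2 * TY)
      = (\<Sum>b\<in>Basis. 2 * (X\<^sup>2 * (b \<bullet> p)\<^sup>2 - 2 * X * Y * ((b \<bullet> p) * (b \<bullet> q)) + Y\<^sup>2 * (b \<bullet> q)\<^sup>2)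
        + 2 * D * (X\<^sup>2 * hess_w t x b - Y\<^sup>2 * hess_w t y b))"
      by (simp only: sum.distrib sum_subtractf sum_Basis_inner_sq sum_Basis_inner_prod TX TY pp qq
        p_def[symmetric] q_def[symmetric] flip: sum_distrib_left)
    also have "\<dots> \<le> (\<Sum>b\<in>(Basis::'a set). X\<^sup>2 * (4 * M'' * (b \<bullet> x)\<^sup>2 + 2 * M' \<rho>) * r2
        + 8 * X * D * M' \<rho> * ((b \<bullet> x) * (b \<bullet> v)) + 2 * M \<rho> * D\<^sup>2)"
      by (rule sum_mono) (rule b)
    also have "\<dots> = X\<^sup>2 * (4 * M'' * \<rho> + DIM('a) * (2 * M' \<rho>)) * r2 + 8 * X * D * M' \<rho> * (x \<bullet> v) + DIM('a) * (2 * M \<rho> * D\<^sup>2)"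
      by (simp only: sum.distrib sum_Basis_inner_sq sum_Basis_inner_prod sum_constant \<rho>_def
        flip: sum_distrib_left sum_distrib_right)
    also have "\<dots> = X\<^sup>2 * lap * r2 + 4 * X * D * j + 2 * M \<rho> * DIM('a) * D\<^sup>2"
      by (simp add: lap j \<rho>_def v_def algebra_simps)
    finally show ?thesis .
  qed
  have Xp: "X > 0" using w_pos t by (simp add: X)
  have YX: "Y = X - D" by (simp add: D_def)
  have Dqq: "D\<^sup>2 * qq = (M \<rho>)\<^sup>2 * r2"
    unfolding qq' Dk(2)[symmetric] by (simp add: power2_eq_square)
  have Dkm: "2 * (D * k * (X * (mv * j))) = r2 * (X * (mv * j))"
    unfolding Dk(1)[symmetric] by simp
  \<comment> \<open>The left side is |X p - Y q|^2 = |D q + X k g|^2; the square of \<open>g\<close>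
    is discarded.\<close>
  have c1: "X\<^sup>2 * pp - 2 * X * Y * (p \<bullet> q) + Y\<^sup>2 * qq \<ge> (M \<rho>)\<^sup>2 * r2 + r2 * (X * (mv * j))"
  proof -
    have "X\<^sup>2 * pp - 2 * X * Y * (p \<bullet> q) + Y\<^sup>2 * qq
        = D\<^sup>2 * qq + 2 * (D * k * (X * (mv * j))) + X\<^sup>2 * (k * k * gg)"
      unfolding pq pp' YX by (simp add: power2_eq_square algebra_simps)
    also have "\<dots> \<ge> D\<^sup>2 * qq + 2 * (D * k * (X * (mv * j)))" using gg by simp
    finally show ?thesis unfolding Dqq Dkm .
  qed
  have c2: "D * (X * pp - Y * qq) \<ge> (M \<rho>)\<^sup>2 * r2 + r2 * (X * (mv * j))"
  proof -
    have "D * (X * pp - Y * qq) = D\<^sup>2 * qq + 2 * (D * k * (X * (mv * j))) + D * (X * (k * k * gg))"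
      unfolding pp' YX by (simp add: power2_eq_square algebra_simps)
    also have "\<dots> \<ge> D\<^sup>2 * qq + 2 * (D * k * (X * (mv * j)))" using gg D Xp by simp
    finally show ?thesis unfolding Dqq Dkm .
  qed
  define rhs where "rhs = X\<^sup>2 * lap * r2 / 2 + 2 * X * D * j + M \<rho> * DIM('a) * D\<^sup>2"
  \<comment> \<open>The square from the second order condition and the gradient terms of the
    equation share this lower bound. Their coefficients |\<gamma>| and 2 - |\<gamma>| add up to 2,
    so \<gamma> drops out of the dissipation.\<close>
  define E where "E = (M \<rho>)\<^sup>2 * r2 + r2 * (X * (mv * j))"
  have "D * (X\<^sup>2 * TX - Y\<^sup>2 * TY) \<le> rhs - E"
    using second c1 by (simp add: rhs_def E_def)
  then have "- \<gamma> * (D * (X\<^sup>2 * TX - Y\<^sup>2 * TY)) \<le> - \<gamma> * (rhs - E)"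
    using gamma by (intro mult_left_mono) auto
  moreover have "(2 + \<gamma>) * E \<le> (2 + \<gamma>) * (D * (X * pp - Y * qq))"
    using c2 gamma_bound by (intro mult_left_mono) (auto simp: E_def)
  moreover have "D * ((- \<gamma> * X\<^sup>2 * TX - (2 + \<gamma>) * X * pp) - (- \<gamma> * Y\<^sup>2 * TY - (2 + \<gamma>) * Y * qq))
     = - \<gamma> * (D * (X\<^sup>2 * TX - Y\<^sup>2 * TY)) - (2 + \<gamma>) * (D * (X * pp - Y * qq))"
    by (simp add: algebra_simps)
  ultimately have "D * ((- \<gamma> * X\<^sup>2 * TX - (2 + \<gamma>) * X * pp) - (- \<gamma> * Y\<^sup>2 * TY - (2 + \<gamma>) * Y * qq))
    \<le> - \<gamma> * (rhs - E) - (2 + \<gamma>) * E" by linarith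
  also have "\<dots> = - \<gamma> * rhs - 2 * E" by (simp add: algebra_simps)
  also have "2 * E = 2 * (M \<rho>)\<^sup>2 * r2 + 2 * X * r2 * M \<rho> * j / D"
    by (simp add: E_def mv_def)
  finally show ?thesis by (simp add: rhs_def D_def \<rho>_def)
qed

end

text \<open>Here g stands for |\<gamma>|, e for the cutoff 1 - \<mu> ln(1 + \<rho>), and M, M1, M2
  for the weight and its derivatives in \<rho>. The growth bound on X cancels the factors 1/(1 +
  \<rho>) of the derivatives, leaving errors of size \<mu> e^-4. The weight carries the power e^-2
  so that its square has this same order; the slack c a - 1 then absorbs the errors. What stems from
  the excess \<zeta> stays on the right.\<close>

lemma doubled_rate_bound:
  fixes d g c C a \<tau> \<mu> e \<rho> X D r2 \<zeta> j :: real
  assumes d: "0 \<le> d" and g: "0 \<le> g" "g \<le> 1" and c: "c = 4 - 2 * d * g" and C: "0 < C" and a: "0 < a"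
    and \<tau>: "0 < \<tau>" "\<tau> \<le> T" and \<mu>: "0 < \<mu>" "\<mu> \<le> 1" and e: "0 < e" "e \<le> 1" and \<rho>: "0 \<le> \<rho>"
    and small: "(C * T * (24 + 4 * d) + 32 * sqrt (C * a * T)) * \<mu> \<le> c * a - 1"
    and X: "0 \<le> X" "X\<^sup>2 \<le> C * (1 + \<rho>)" and D: "0 < D" and r2: "0 \<le> r2" and \<zeta>: "0 \<le> \<zeta>"
    and D2: "D\<^sup>2 = M * r2 + \<zeta>" and j: "j\<^sup>2 \<le> 4 * M1\<^sup>2 * \<rho> * r2"
    and M: "M = a / \<tau> / e\<^sup>2" and M1: "M1 = a / \<tau> * (2 * \<mu> / ((1 + \<rho>) * e ^ 3))"
    and M2: "M2 = a / \<tau> * (6 * \<mu>\<^sup>2 / ((1 + \<rho>)\<^sup>2 * e ^ 4) - 2 * \<mu> / ((1 + \<rho>)\<^sup>2 * e ^ 3))"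
    and lap: "lap = 4 * \<rho> * M2 + 2 * d * M1"
  shows "g * (X\<^sup>2 * lap * r2 / 2 + 2 * X * D * j + M * d * D\<^sup>2) - 2 * M\<^sup>2 * r2 - 2 * X * r2 * M * j / D
      + a / \<tau>\<^sup>2 / e\<^sup>2 * r2 / 2 \<le> (8 * sqrt C * sqrt (a / \<tau>) / e\<^sup>2 + d * M) * \<zeta>"
proof -
  define \<kappa> where "\<kappa> = a / \<tau>"
  define S where "S = sqrt C"
  define k where "k = sqrt \<kappa>"
  have \<kappa>: "\<kappa> > 0" using a \<tau> by (simp add: \<kappa>_def)
  have k: "k > 0" "k * k = \<kappa>" using \<kappa> by (auto simp: k_def)
  have S: "S > 0" "S * S = C" using C by (auto simp: S_def)
  define \<sigma> where "\<sigma> = k / e"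
  have \<sigma>: "\<sigma> > 0" using k e by (simp add: \<sigma>_def)
  have M\<sigma>: "M = \<sigma>\<^sup>2" using k(2) by (simp add: M \<sigma>_def \<kappa>_def[symmetric] power2_eq_square)
  have Mpos: "M > 0" using \<sigma> by (simp add: M\<sigma>)
  have M1pos: "M1 \<ge> 0" using a \<tau> \<mu> e \<rho> by (simp add: M1)
  define r where "r = sqrt r2"
  have r: "r \<ge> 0" "r\<^sup>2 = r2" using r2 by (auto simp: r_def)
  define Gn where "Gn = 2 * M1 * sqrt \<rho>"
  have Gn: "Gn \<ge> 0" using M1pos \<rho> by (simp add: Gn_def)
  have jG: "\<bar>j\<bar> \<le> Gn * r"
  proof (rule power2_le_imp_le)
    show "\<bar>j\<bar>\<^sup>2 \<le> (Gn * r)\<^sup>2" using j \<rho> r by (simp add: Gn_def power_mult_distrib)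
  qed (use Gn r in simp)
  \<comment> \<open>With \<open>\<sigma>\<close> the square root of the weight, this controls the
    term divided by \<open>D\<close> and lets \<open>D * r\<close> be traded for
    \<open>D\<^sup>2 / \<sigma>\<close>.\<close>
  have \<sigma>r: "\<sigma> * r \<le> D"
  proof (rule power2_le_imp_le)
    show "(\<sigma> * r)\<^sup>2 \<le> D\<^sup>2" using \<zeta> by (simp add: power_mult_distrib r D2 M\<sigma>)
  qed (use D in simp)
  \<comment> \<open>\<open>Gn\<close> is the length of the gradient of the weight. Growth gives
    \<open>X * sqrt \<rho> \<le> S * (1 + \<rho>)\<close>, exactly the denominator in
    \<open>M1\<close>.\<close>
  have XG: "X * Gn \<le> 4 * S * \<kappa> * \<mu> / e ^ 3"
  proof -
    have "X * sqrt \<rho> \<le> S * (1 + \<rho>)"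
    proof (rule power2_le_imp_le)
      have "(X * sqrt \<rho>)\<^sup>2 = X\<^sup>2 * \<rho>" using \<rho> by (simp add: power_mult_distrib)
      also have "\<dots> \<le> (C * (1 + \<rho>)) * (1 + \<rho>)" using X \<rho> C by (intro mult_mono) auto
      also have "\<dots> = (S * (1 + \<rho>))\<^sup>2" by (simp add: S(2)[symmetric] power2_eq_square)
      finally show "(X * sqrt \<rho>)\<^sup>2 \<le> (S * (1 + \<rho>))\<^sup>2" .
    qed (use S \<rho> in simp)
    then have "X * sqrt \<rho> * (2 * M1) \<le> S * (1 + \<rho>) * (2 * M1)" using M1pos by (intro mult_right_mono) auto
    also have "\<dots> = 4 * S * \<kappa> * \<mu> / e ^ 3" using \<rho> by (simp add: M1 \<kappa>_def[symmetric])
    finally show ?thesis by (simp add: Gn_def mult_ac)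
  qed
  have X\<sigma>G: "X * Gn * \<sigma> \<le> 4 * S * \<kappa> * k * \<mu> / e ^ 4"
  proof -
    have "X * Gn * \<sigma> \<le> 4 * S * \<kappa> * \<mu> / e ^ 3 * \<sigma>" using XG \<sigma> by (intro mult_right_mono) auto
    also have "\<dots> = 4 * S * \<kappa> * k * \<mu> / e ^ 4" by (simp add: \<sigma>_def power4_eq_xxxx power3_eq_cube)
    finally show ?thesis .
  qed
  have XG\<sigma>: "X * Gn / \<sigma> \<le> 4 * S * k / e\<^sup>2"
  proof -
    have "X * Gn / \<sigma> \<le> 4 * S * \<kappa> * \<mu> / e ^ 3 / \<sigma>" using XG \<sigma> by (intro divide_right_mono) auto
    also have "\<dots> = 4 * S * k / e\<^sup>2 * \<mu>"
      using k e by (simp add: \<sigma>_def power2_eq_square power3_eq_cube k(2)[symmetric])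
    also have "\<dots> \<le> 4 * S * k / e\<^sup>2 * 1" using \<mu> S k by (intro mult_left_mono) auto
    finally show ?thesis by simp
  qed
  have t1: "g * (X\<^sup>2 * lap * r2 / 2) \<le> C * \<kappa> * (24 + 4 * d) * \<mu> / e ^ 4 * r2 / 2"
  proof -
    define W where "W = \<kappa> * (24 + 4 * d) * \<mu> / ((1 + \<rho>) * e ^ 4)"
    have W: "W \<ge> 0" using \<kappa> d \<mu> e \<rho> by (simp add: W_def)
    have "4 * \<rho> * M2 \<le> \<kappa> * (24 * \<mu> / ((1 + \<rho>) * e ^ 4))"
    proof -
      have "4 * \<rho> * M2 \<le> 4 * \<rho> * (\<kappa> * (6 * \<mu>\<^sup>2 / ((1 + \<rho>)\<^sup>2 * e ^ 4)))"
        unfolding M2 \<kappa>_def[symmetric] using \<rho> \<mu> e \<kappa> by (intro mult_left_mono) auto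
      also have "\<dots> = \<kappa> * (24 / ((1 + \<rho>) * e ^ 4)) * (\<rho> / (1 + \<rho>) * \<mu>\<^sup>2)"
        using \<rho> e by (simp add: power2_eq_square field_simps)
      also have "\<dots> \<le> \<kappa> * (24 / ((1 + \<rho>) * e ^ 4)) * (1 * \<mu>)"
        using \<rho> \<mu> \<kappa> e by (intro mult_left_mono mult_mono) (auto simp: power2_eq_square mult_left_le)
      finally show ?thesis by simp
    qed
    moreover have "2 * d * M1 \<le> \<kappa> * (4 * d * \<mu> / ((1 + \<rho>) * e ^ 4))"
    proof -
      have "4 * d * \<mu> / ((1 + \<rho>) * e ^ 3) \<le> 4 * d * \<mu> / ((1 + \<rho>) * e ^ 4)"
        using d \<mu> \<rho> e by (intro divide_left_mono mult_left_mono power_decreasing mult_pos_pos) auto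
      from mult_left_mono[OF this, of \<kappa>] show ?thesis
        using \<kappa> by (simp add: M1 \<kappa>_def[symmetric] mult_ac)
    qed
    ultimately have lW: "lap \<le> W" by (simp add: lap W_def add_divide_distrib algebra_simps)
    have "g * (X\<^sup>2 * lap * r2 / 2) \<le> g * (X\<^sup>2 * W * r2 / 2)"
      using g r2 lW by (intro mult_left_mono divide_right_mono mult_right_mono) auto
    also have "\<dots> \<le> 1 * (C * (1 + \<rho>) * W * r2 / 2)"
      using g r2 W X C \<rho> by (intro mult_mono divide_right_mono mult_right_mono) auto
    also have "C * (1 + \<rho>) * W = C * \<kappa> * (24 + 4 * d) * \<mu> / e ^ 4"
      using \<rho> by (simp add: W_def)
    finally show ?thesis by simp
  qed
  have t2: "g * (2 * X * D * j) \<le> 2 * (X * Gn * \<sigma>) * r2 + 2 * (X * Gn / \<sigma>) * \<zeta>"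
  proof -
    have "g * (2 * X * D * j) \<le> g * (2 * X * D * (Gn * r))"
      using g X D jG by (intro mult_left_mono) auto
    also have "\<dots> \<le> 1 * (2 * X * D * (Gn * r))"
      using g X D Gn r by (intro mult_right_mono) auto
    also have "\<dots> = 2 * X * Gn * (D * r)" by simp
    also have "\<dots> \<le> 2 * X * Gn * (D\<^sup>2 / \<sigma>)"
    proof -
      have "D * (\<sigma> * r) \<le> D * D" using \<sigma>r D by (intro mult_left_mono) auto
      then have "D * r \<le> D\<^sup>2 / \<sigma>" using \<sigma> by (simp add: pos_le_divide_eq power2_eq_square mult_ac)
      then show ?thesis using X Gn by (intro mult_left_mono) auto
    qed
    also have "D\<^sup>2 / \<sigma> = \<sigma> * r2 + \<zeta> / \<sigma>" unfolding D2 M\<sigma> using \<sigma> by (simp add: power2_eq_square add_divide_distrib)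
    finally show ?thesis by (simp add: algebra_simps)
  qed
  have t3: "- 2 * X * r2 * M * j / D \<le> 2 * (X * Gn * \<sigma>) * r2"
  proof -
    have "- 2 * X * r2 * M * j / D = 2 * X * r2 * M / D * (- j)" by simp
    also have "\<dots> \<le> 2 * X * r2 * M / D * (Gn * r)"
      using X r2 Mpos D jG by (intro mult_left_mono) auto
    also have "\<dots> = 2 * X * r2 * Gn * \<sigma> * (\<sigma> * r / D)" by (simp add: M\<sigma> power2_eq_square)
    also have "\<dots> \<le> 2 * X * r2 * Gn * \<sigma> * 1"
      using X r2 Gn \<sigma> D \<sigma>r by (intro mult_left_mono) auto
    finally show ?thesis by (simp add: mult_ac)
  qed
  have t4: "g * (M * d * D\<^sup>2) \<le> g * d * M\<^sup>2 * r2 + d * M * \<zeta>"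
  proof -
    have "g * (M * d * D\<^sup>2) = g * d * M\<^sup>2 * r2 + g * (d * M * \<zeta>)"
      unfolding D2 by (simp add: power2_eq_square algebra_simps)
    also have "g * (d * M * \<zeta>) \<le> 1 * (d * M * \<zeta>)"
      using g d Mpos \<zeta> by (intro mult_right_mono) auto
    finally show ?thesis by simp
  qed
  \<comment> \<open>After extracting the factor a / (2 \<tau>^2 e^4) this is the fact
    \<open>neg\<close> below. The 32 collects the first order errors of \<open>t2\<close> and
    \<open>t3\<close>, the 24 + 4 d the second order error of \<open>t1\<close>; the time derivative
    of the weight leaves e^2, which is at most 1.\<close>
  have main: "C * \<kappa> * (24 + 4 * d) * \<mu> / e ^ 4 / 2 + 4 * (4 * S * \<kappa> * k * \<mu> / e ^ 4) + (g * d - 2) * M\<^sup>2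
      + a / \<tau>\<^sup>2 / e\<^sup>2 / 2 \<le> 0"
  proof -
    have "\<tau> * k = sqrt (a * \<tau>)"
    proof (rule real_sqrt_unique[symmetric])
      have "(\<tau> * k)\<^sup>2 = \<tau> * \<tau> * (k * k)" by (simp add: power2_eq_square)
      then show "(\<tau> * k)\<^sup>2 = a * \<tau>" using \<tau> unfolding k(2) \<kappa>_def by simp
    qed (use k \<tau> in simp)
    also have "sqrt (a * \<tau>) \<le> sqrt (a * T)" using a \<tau> by simp
    finally have "S * (\<tau> * k) \<le> S * sqrt (a * T)" using S by (intro mult_left_mono) auto
    also have "\<dots> = sqrt (C * a * T)" by (simp add: S_def mult.assoc flip: real_sqrt_mult)
    finally have Sk: "S * (\<tau> * k) \<le> sqrt (C * a * T)" .
    have "(C * \<tau> * (24 + 4 * d) + 32 * (S * (\<tau> * k))) * \<mu> \<le> (C * T * (24 + 4 * d) + 32 * sqrt (C * a * T)) * \<mu>"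
      using Sk \<mu> C \<tau> d by (intro mult_right_mono add_mono mult_left_mono) auto
    also have "\<dots> \<le> c * a - 1" by (rule small)
    also have "\<dots> \<le> c * a - e\<^sup>2" using e by (simp add: power_le_one)
    finally have neg: "(C * \<tau> * (24 + 4 * d) + 32 * (S * (\<tau> * k))) * \<mu> - c * a + e\<^sup>2 \<le> 0" by simp
    define i where "i = inverse \<tau>"
    define f where "f = inverse (e\<^sup>2)"
    have i: "i * \<tau> = 1" using \<tau> by (simp add: i_def)
    have f: "f * e\<^sup>2 = 1" using e by (simp add: f_def)
    have f4: "inverse (e ^ 4) = f * f" by (simp add: f_def power4_eq_xxxx power2_eq_square)
    have ipos: "i \<ge> 0" "f \<ge> 0" using \<tau> by (auto simp: i_def f_def)
    have M': "M = a * i * f" and \<kappa>': "\<kappa> = a * i" and it: "a / \<tau>\<^sup>2 / e\<^sup>2 = a * i * i * f"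
      by (simp_all add: M \<kappa>_def i_def f_def divide_inverse power2_eq_square)
    have "C * \<kappa> * (24 + 4 * d) * \<mu> / e ^ 4 / 2 + 4 * (4 * S * \<kappa> * k * \<mu> / e ^ 4) + (g * d - 2) * M\<^sup>2 + a / \<tau>\<^sup>2 / e\<^sup>2 / 2
      = a * i * (f * f) / 2 * (C * (24 + 4 * d) * \<mu> + 32 * (S * k) * \<mu> - c * a * i) + a * i * i * f / 2"
      unfolding it divide_inverse[of _ "e ^ 4"] f4 M' \<kappa>' c by (simp add: power2_eq_square field_simps)
    also have "\<dots> = a * i * (f * f) / 2 * (C * (i * \<tau>) * (24 + 4 * d) * \<mu> + 32 * (S * (i * \<tau>) * k) * \<mu> - c * a * i) + a * i * i * f * (f * e\<^sup>2) / 2"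
      unfolding i f by simp
    also have "\<dots> = a * i * i * (f * f) / 2 * ((C * \<tau> * (24 + 4 * d) + 32 * (S * (\<tau> * k))) * \<mu> - c * a + e\<^sup>2)"
      by (simp add: field_simps)
    also have "\<dots> \<le> 0" using neg a ipos by (intro mult_nonneg_nonpos) auto
    finally show ?thesis .
  qed
  have "g * (X\<^sup>2 * lap * r2 / 2 + 2 * X * D * j + M * d * D\<^sup>2) - 2 * M\<^sup>2 * r2 - 2 * X * r2 * M * j / D
      + a / \<tau>\<^sup>2 / e\<^sup>2 * r2 / 2
    = g * (X\<^sup>2 * lap * r2 / 2) + g * (2 * X * D * j) + g * (M * d * D\<^sup>2) + (- 2 * X * r2 * M * j / D) - 2 * M\<^sup>2 * r2
      + a / \<tau>\<^sup>2 / e\<^sup>2 / 2 * r2"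
    by (simp add: distrib_left)
  also have "\<dots> \<le> C * \<kappa> * (24 + 4 * d) * \<mu> / e ^ 4 * r2 / 2 + (2 * (X * Gn * \<sigma>) * r2 + 2 * (X * Gn / \<sigma>) * \<zeta>)
      + (g * d * M\<^sup>2 * r2 + d * M * \<zeta>) + 2 * (X * Gn * \<sigma>) * r2 - 2 * M\<^sup>2 * r2 + a / \<tau>\<^sup>2 / e\<^sup>2 / 2 * r2"
    using t1 t2 t3 t4 by linarith
  also have "\<dots> = (C * \<kappa> * (24 + 4 * d) * \<mu> / e ^ 4 / 2 + 4 * (X * Gn * \<sigma>) + (g * d - 2) * M\<^sup>2 + a / \<tau>\<^sup>2 / e\<^sup>2 / 2) * r2
      + (2 * (X * Gn / \<sigma>) + d * M) * \<zeta>"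
    by (simp add: algebra_simps)
  also have "\<dots> \<le> 0 * r2 + (2 * (4 * S * k / e\<^sup>2) + d * M) * \<zeta>"
  proof (rule add_mono[OF mult_right_mono[OF _ r2] mult_right_mono[OF _ \<zeta>]])
    show "C * \<kappa> * (24 + 4 * d) * \<mu> / e ^ 4 / 2 + 4 * (X * Gn * \<sigma>) + (g * d - 2) * M\<^sup>2 + a / \<tau>\<^sup>2 / e\<^sup>2 / 2 \<le> 0"
      using main X\<sigma>G by linarith
    show "2 * (X * Gn / \<sigma>) + d * M \<le> 2 * (4 * S * k / e\<^sup>2) + d * M"
      using XG\<sigma> by linarith
  qed
  finally show ?thesis by (simp add: S_def k_def \<kappa>_def mult.assoc)
qed

section \<open>Maximum principle for the doubled function\<close>

context fast_diffusion
begin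

text \<open>Infiniteness of the right-hand side at \<open>t = s\<close> and where the logarithm reaches \<open>1/\<mu>\<close>,
  together with the local Lipschitz bound for \<open>w\<close>, confines the maximum to a compact set.\<close>

lemma doubling_estimate:
  assumes s: "0 < s" and C: "C > 0"
    and growth: "\<And>t x. s \<le> t \<Longrightarrow> t \<le> T \<Longrightarrow> n t x powr \<gamma> \<le> C * (1 + x \<bullet> x)"
    and a: "a > 0" and \<mu>: "0 < \<mu>" "\<mu> \<le> 1"
    and c: "c = 4 + 2 * real DIM('a) * \<gamma>"
    and small: "(C * T * (24 + 4 * real DIM('a)) + 32 * sqrt (C * a * T)) * \<mu> \<le> c * a - 1"
    and t1: "s < t1" "t1 \<le> T" and x1: "\<mu> * ln (1 + x1 \<bullet> x1) < 1" and y1: "w t1 y1 \<le> w t1 x1"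
  shows "(w t1 x1 - w t1 y1)\<^sup>2 \<le> a / (t1 - s) / (1 - \<mu> * ln (1 + x1 \<bullet> x1))\<^sup>2 * ((x1 - y1) \<bullet> (x1 - y1))"
proof (rule ccontr)
  assume contra: "\<not> ?thesis"
  have T: "T > 0" using s t1 by simp
  define e where "e = (\<lambda>r::real. 1 - \<mu> * ln (1 + r))"
  define M where "M = (\<lambda>t r. a / (t - s) / (e r)\<^sup>2)"
  \<comment> \<open>The cutoff restrains only x. Taking the positive part makes w(x) the larger
    value, so its bound on the cutoff region controls the difference.\<close>
  define P where "P = (\<lambda>t x y. max 0 (w t x - w t y))"
  define bad where "bad = (\<lambda>t x y. s < t \<and> t \<le> T \<and> 0 < e (x \<bullet> x) \<and> M t (x \<bullet> x) * ((x - y) \<bullet> (x - y)) < (P t x y)\<^sup>2)"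
  have bad1: "bad t1 x1 y1"
    using t1 x1 y1 contra by (simp add: bad_def e_def M_def P_def not_le)
  define R0 where "R0 = sqrt (exp (1 / \<mu>))"
  define W where "W = sqrt (C * (1 + exp (1 / \<mu>)))"
  \<comment> \<open>The cutoff keeps |x| below \<open>R0\<close>. Where the estimate fails, the
    difference is at most \<open>W\<close> and the weight at least a/T, which keeps |x - y| below
    \<open>W * sqrt (T / a)\<close>.\<close>
  define R where "R = R0 + W * sqrt (T / a) + 1"
  obtain \<Lambda> where \<Lambda>: "\<Lambda> > 0" "\<And>t x y. t \<in> {s..T} \<Longrightarrow> x \<in> cball 0 R \<Longrightarrow> y \<in> cball 0 R \<Longrightarrow> \<bar>w t x - w t y\<bar> \<le> \<Lambda> * norm (x - y)"
    using w_Lipschitz[OF s] by blast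
  \<comment> \<open>Where the estimate fails, the weight is smaller than
    \<open>\<Lambda>\<^sup>2\<close>. As it dominates both a/(t - s) and a/(T e^2), this bounds t -
    s and e from below by \<open>\<tau>0\<close> and \<open>\<eta>\<close>.\<close>
  define \<tau>0 where "\<tau>0 = a / \<Lambda>\<^sup>2"
  define \<eta> where "\<eta> = sqrt (a / T) / \<Lambda>"
  have \<tau>0: "\<tau>0 > 0" and \<eta>: "\<eta> > 0" using a \<Lambda> T by (auto simp: \<tau>0_def \<eta>_def)
  have W: "W > 0" using C by (simp add: W_def add_pos_pos)
  have e_le: "e r \<le> 1" if "r \<ge> 0" for r using that \<mu> by (simp add: e_def)
  have ball0: "norm x \<le> R0" if "e (x \<bullet> x) > 0" for x :: 'a
  proof -
    have "ln (1 + x \<bullet> x) \<le> ln (exp (1 / \<mu>))" using that \<mu> by (simp add: e_def field_simps)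
    then have "1 + x \<bullet> x \<le> exp (1 / \<mu>)" by (subst (asm) ln_le_cancel_iff) (auto simp: add_pos_nonneg)
    then show ?thesis unfolding R0_def norm_eq_sqrt_inner by simp
  qed
  have wW: "w t x \<le> W" if "s < t" "t \<le> T" "e (x \<bullet> x) > 0" for t x
  proof -
    have "(norm x)\<^sup>2 \<le> R0\<^sup>2" using ball0[OF that(3)] by (intro power_mono) auto
    then have "x \<bullet> x \<le> exp (1 / \<mu>)" by (simp add: R0_def power2_norm_eq_inner)
    then have "C * (1 + x \<bullet> x) \<le> C * (1 + exp (1 / \<mu>))" using C by (intro mult_left_mono) auto
    moreover have "(w t x)\<^sup>2 \<le> C * (1 + x \<bullet> x)" unfolding w_sq using that by (intro growth) auto
    ultimately show ?thesis unfolding W_def by (intro real_le_rsqrt) simp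
  qed
  \<comment> \<open>The inequalities are strict so that a bad point can lie on the boundary of the
    compact set \<open>S\<close> only through t = T.\<close>
  have strict: "s + \<tau>0 < t" "\<eta> < e (x \<bullet> x)" "norm y < R" "w t y < w t x" "M t (x \<bullet> x) < \<Lambda>\<^sup>2" if "bad t x y" for t x y
  proof -
    have b: "s < t" "t \<le> T" "0 < e (x \<bullet> x)" and Mr: "M t (x \<bullet> x) * ((x - y) \<bullet> (x - y)) < (P t x y)\<^sup>2"
      using that by (auto simp: bad_def)
    have t0: "t > 0" using s b by simp
    define r where "r = norm (x - y)"
    have Mr: "M t (x \<bullet> x) * r\<^sup>2 < (P t x y)\<^sup>2" using Mr by (simp add: r_def power2_norm_eq_inner)
    have Mpos: "M t (x \<bullet> x) > 0" using a b by (simp add: M_def)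
    show w: "w t y < w t x"
    proof (rule ccontr)
      assume "\<not> w t y < w t x"
      then have "M t (x \<bullet> x) * r\<^sup>2 < 0" using Mr by (simp add: P_def)
      then show False using Mpos by (simp add: mult_less_0_iff)
    qed
    have Mr: "M t (x \<bullet> x) * r\<^sup>2 < (w t x - w t y)\<^sup>2" using Mr w by (simp add: P_def)
    have e2: "(e (x \<bullet> x))\<^sup>2 \<le> 1" using e_le[of "x \<bullet> x"] b by (simp add: power_le_one)
    have M1: "a / (t - s) \<le> M t (x \<bullet> x)"
    proof -
      have "a / (t - s) / 1 \<le> M t (x \<bullet> x)" unfolding M_def
        using e2 b a by (intro divide_left_mono) auto
      then show ?thesis by simp
    qed
    have M2: "a / T / (e (x \<bullet> x))\<^sup>2 \<le> M t (x \<bullet> x)"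
      unfolding M_def using a b s T by (intro divide_right_mono divide_left_mono) auto
    have M3: "a / T \<le> M t (x \<bullet> x)"
    proof -
      have "a / T \<le> a / (t - s)" using a b s T by (intro divide_left_mono) auto
      then show ?thesis using M1 by simp
    qed
    have rW: "r < W * sqrt (T / a)"
    proof -
      have "a / T * r\<^sup>2 \<le> M t (x \<bullet> x) * r\<^sup>2" using M3 by (intro mult_right_mono) auto
      also note Mr
      also have "(w t x - w t y)\<^sup>2 \<le> W\<^sup>2"
        using w wW[OF b] w_pos[OF t0, of y] by (intro power_mono) auto
      finally have "r\<^sup>2 < W\<^sup>2 * (T / a)" using a T by (simp add: field_simps)
      also have "\<dots> = (W * sqrt (T / a))\<^sup>2" using a T by (simp add: power_mult_distrib)
      finally show ?thesis by (rule power_less_imp_less_base) (use W a T in simp)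
    qed
    have nx: "norm x \<le> R0" by (rule ball0) (rule b)
    have "norm y \<le> norm x + norm (x - y)" by (metis add.commute norm_minus_commute norm_triangle_sub)
    then show ny: "norm y < R" using nx rW by (simp add: R_def r_def)
    have "norm x \<le> R" using nx W a T by (simp add: R_def add_nonneg_nonneg add_increasing2)
    then have "\<bar>w t x - w t y\<bar> \<le> \<Lambda> * r" unfolding r_def using b ny by (intro \<Lambda>) auto
    then have "(w t x - w t y)\<^sup>2 \<le> (\<Lambda> * r)\<^sup>2" using w by (intro power_mono) auto
    then have "M t (x \<bullet> x) * r\<^sup>2 < \<Lambda>\<^sup>2 * r\<^sup>2" using Mr by (simp add: power_mult_distrib)
    then show M_lt: "M t (x \<bullet> x) < \<Lambda>\<^sup>2" using mult_less_cancel_right_pos by (metis mult_less_cancel_right not_less zero_le_power2)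
    have "a / (t - s) < \<Lambda>\<^sup>2" using M1 M_lt by simp
    then show "s + \<tau>0 < t" using b \<Lambda> by (simp add: \<tau>0_def field_simps)
    have "a / T / (e (x \<bullet> x))\<^sup>2 < \<Lambda>\<^sup>2" using M2 M_lt by simp
    moreover have "0 < (e (x \<bullet> x))\<^sup>2" using b by simp
    ultimately have "a / T < (e (x \<bullet> x))\<^sup>2 * \<Lambda>\<^sup>2" by (simp only: pos_divide_less_eq mult.commute)
    then have "a / T / \<Lambda>\<^sup>2 < (e (x \<bullet> x))\<^sup>2" using \<Lambda>(1) by (simp only: pos_divide_less_eq zero_less_power)
    then have "\<eta>\<^sup>2 < (e (x \<bullet> x))\<^sup>2" using a T by (simp add: \<eta>_def power_divide)
    then show "\<eta> < e (x \<bullet> x)" by (rule power_less_imp_less_base) (use b in simp)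
  qed
  \<comment> \<open>At a bad point the coefficient of the excess \<open>\<zeta>\<close> in the rate
    bound is at most (L - 1)/2; the added 1 yields the contradiction.\<close>
  define L where "L = 2 * (8 * sqrt C * \<Lambda> / \<eta>\<^sup>2 + real DIM('a) * \<Lambda>\<^sup>2) + 1"
  define \<Psi> where "\<Psi> = (\<lambda>(t, x, y). exp (- L * t) * ((P t x y)\<^sup>2 - M t (x \<bullet> x) * ((x - y) \<bullet> (x - y))))"
  define S where "S = {s + \<tau>0..T} \<times> {x::'a. \<eta> \<le> e (x \<bullet> x)} \<times> cball (0::'a) R"
  have cont_e: "continuous_on UNIV (\<lambda>x::'a. e (x \<bullet> x))"
  proof -
    have "1 + x \<bullet> x \<noteq> 0" for x :: 'a by (metis add_pos_nonneg inner_ge_zero less_irrefl zero_less_one)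
    then show ?thesis unfolding e_def by (intro continuous_intros) auto
  qed
  have cS: "compact S"
  proof -
    have "closed {x::'a. \<eta> \<le> e (x \<bullet> x)}" by (intro closed_Collect_le continuous_intros cont_e)
    moreover have "bounded {x::'a. \<eta> \<le> e (x \<bullet> x)}"
      by (rule bounded_subset[of "cball 0 R0"]) (use \<eta> ball0 in \<open>force+\<close>)
    ultimately have "compact {x::'a. \<eta> \<le> e (x \<bullet> x)}" by (simp add: compact_eq_bounded_closed)
    then show ?thesis unfolding S_def by (intro compact_Times) auto
  qed
  have cont_\<Psi>: "continuous_on S \<Psi>"
  proof -
    have w1: "continuous_on S (\<lambda>z. w (fst z) (fst (snd z)))" "continuous_on S (\<lambda>z. w (fst z) (snd (snd z)))"
      by (rule continuous_on_compose2[OF continuous_on_w, where f = "\<lambda>z. (fst z, fst (snd z))", simplified],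
          auto intro!: continuous_intros simp: S_def) (use s \<tau>0 in auto,
        rule continuous_on_compose2[OF continuous_on_w, where f = "\<lambda>z. (fst z, snd (snd z))", simplified],
          auto intro!: continuous_intros simp: S_def)
    have e1: "continuous_on S (\<lambda>z. e (fst (snd z) \<bullet> fst (snd z)))"
      by (rule continuous_on_compose2[OF cont_e]) (auto intro!: continuous_intros)
    have nz: "fst z - s \<noteq> 0" "e (fst (snd z) \<bullet> fst (snd z)) \<noteq> 0" if "z \<in> S" for z
      using that \<tau>0 \<eta> by (auto simp: S_def)
    show ?thesis
      unfolding \<Psi>_def P_def M_def split_def
      by (intro continuous_intros w1 e1) (use nz in auto)
  qed
  have inS: "(t, x, y) \<in> S" if "bad t x y" for t x y
    using strict[OF that] that by (auto simp: S_def bad_def)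
  obtain t x y where tS: "(t, x, y) \<in> S" and mx: "\<And>t' x' y'. (t', x', y') \<in> S \<Longrightarrow> \<Psi> (t', x', y') \<le> \<Psi> (t, x, y)"
  proof -
    have "S \<noteq> {}" using inS[OF bad1] by auto
    from continuous_attains_sup[OF cS this cont_\<Psi>] show ?thesis using that by (metis surj_pair)
  qed
  have "\<Psi> (t1, x1, y1) > 0" using bad1 by (simp add: \<Psi>_def bad_def)
  then have pos\<Psi>: "\<Psi> (t, x, y) > 0" using mx[OF inS[OF bad1]] by simp
  have bad: "bad t x y"
    using tS pos\<Psi> \<tau>0 \<eta> by (auto simp: S_def bad_def \<Psi>_def zero_less_mult_iff)
  note st = strict[OF bad]
  have tT: "s < t" "t \<le> T" and ex: "0 < e (x \<bullet> x)" using bad by (auto simp: bad_def)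
  have t0: "t > 0" using s tT by simp
  define \<rho> where "\<rho> = x \<bullet> x"
  have \<rho>: "\<rho> \<ge> 0" by (simp add: \<rho>_def)
  define v where "v = x - y"
  define r2 where "r2 = v \<bullet> v"
  define \<zeta> where "\<zeta> = (w t x - w t y)\<^sup>2 - M t \<rho> * r2"
  have Ptxy: "P t x y = w t x - w t y" using st by (simp add: P_def)
  have \<zeta>: "\<zeta> > 0" using bad Ptxy by (simp add: bad_def \<zeta>_def r2_def v_def \<rho>_def)
  \<comment> \<open>The squared norm 0 is an interior point of this interval, so a maximum at x = 0
    is no special case.\<close>
  define I where "I = {-1<..<exp (1 / \<mu>) - 1}"
  have I: "r \<in> I \<longleftrightarrow> r > -1 \<and> e r > 0" for r
  proof (cases "r > -1")
    case True
    have "e r > 0 \<longleftrightarrow> ln (1 + r) < ln (exp (1 / \<mu>))" using \<mu> by (simp add: e_def field_simps)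
    also have "\<dots> \<longleftrightarrow> 1 + r < exp (1 / \<mu>)" using True by (subst ln_less_cancel_iff) auto
    finally show ?thesis using True by (auto simp: I_def)
  qed (simp add: I_def)
  have \<rho>I: "x \<bullet> x \<in> I" using ex \<rho> less_le_trans[of "-1" 0 "x \<bullet> x"] unfolding I by simp
  define \<kappa> where "\<kappa> = a / (t - s)"
  define M' where "M' = (\<lambda>r. \<kappa> * (2 * \<mu> / ((1 + r) * e r ^ 3)))"
  define M'' where "M'' = \<kappa> * (6 * \<mu>\<^sup>2 / ((1 + \<rho>)\<^sup>2 * e \<rho> ^ 4) - 2 * \<mu> / ((1 + \<rho>)\<^sup>2 * e \<rho> ^ 3))"
  have de: "(e has_real_derivative - (\<mu> / (1 + r))) (at r)" if "r > -1" for r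
    unfolding e_def using that by (auto intro!: derivative_eq_intros)
  have dM: "(M t has_real_derivative M' r) (at r)" if "r \<in> I" for r
  proof -
    have r: "r > -1" "e r > 0" using that by (auto simp: I)
    define q where "q = 1 + r"
    define E where "E = e r"
    have qE: "q \<noteq> 0" "E \<noteq> 0" using r by (auto simp: q_def E_def)
    have "((\<lambda>r. \<kappa> / (e r)\<^sup>2) has_real_derivative - (\<kappa> * (2 * E * - (\<mu> / q))) / (E\<^sup>2 * E\<^sup>2)) (at r)"
      using r by (auto intro!: derivative_eq_intros de simp: E_def q_def)
    moreover have "- (\<kappa> * (2 * E * - (\<mu> / q))) / (E\<^sup>2 * E\<^sup>2) = \<kappa> * (2 * \<mu> / (q * E ^ 3))"
      using qE by (simp add: field_simps power2_eq_square power3_eq_cube)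
    ultimately have "((\<lambda>r. \<kappa> / (e r)\<^sup>2) has_real_derivative M' r) (at r)"
      by (simp add: M'_def E_def q_def)
    then show ?thesis unfolding M_def \<kappa>_def .
  qed
  have dM': "(M' has_real_derivative M'') (at (x \<bullet> x))"
  proof -
    have r: "1 + \<rho> > 0" "e \<rho> > 0" using \<rho>I by (auto simp: I \<rho>_def)
    define q where "q = 1 + \<rho>"
    define E where "E = e \<rho>"
    have qE: "q \<noteq> 0" "E \<noteq> 0" using r by (auto simp: q_def E_def)
    have "((\<lambda>r. (1 + r) * e r ^ 3) has_real_derivative E ^ 3 - 3 * \<mu> * E\<^sup>2) (at \<rho>)"
      using r by (auto intro!: derivative_eq_intros de simp: E_def q_def)
    from DERIV_cmult[OF DERIV_divide[OF DERIV_const[of "2 * \<mu>"] this], of \<kappa>]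
    have "(M' has_real_derivative \<kappa> * (- (2 * \<mu> * (E ^ 3 - 3 * \<mu> * E\<^sup>2)) / ((q * E ^ 3) * (q * E ^ 3)))) (at \<rho>)"
      unfolding M'_def E_def[symmetric] q_def[symmetric] using qE by simp
    moreover have "- (2 * \<mu> * (E ^ 3 - 3 * \<mu> * E\<^sup>2)) / ((q * E ^ 3) * (q * E ^ 3))
        = 6 * \<mu>\<^sup>2 / (q\<^sup>2 * E ^ 4) - 2 * \<mu> / (q\<^sup>2 * E ^ 3)"
      using qE by (simp add: field_simps power2_eq_square power3_eq_cube power4_eq_xxxx)
    ultimately show ?thesis unfolding M''_def \<rho>_def[symmetric] E_def[symmetric] q_def[symmetric] by (simp only:)
  qed
  have spatial: "\<forall>\<^sub>F h in nhds 0.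
      (w t (x + h *\<^sub>R \<xi>) - w t (y + h *\<^sub>R \<eta>'))\<^sup>2
        - M t ((x + h *\<^sub>R \<xi>) \<bullet> (x + h *\<^sub>R \<xi>)) * (((x - y) + h *\<^sub>R (\<xi> - \<eta>')) \<bullet> ((x - y) + h *\<^sub>R (\<xi> - \<eta>')))
      \<le> (w t x - w t y)\<^sup>2 - M t (x \<bullet> x) * ((x - y) \<bullet> (x - y))" for \<xi> \<eta>'
  proof -
    \<comment> \<open>The strict order of the two values persists nearby, so the positive part
      \<open>P\<close> may be replaced by the smooth difference.\<close>
    have "isCont (\<lambda>h. w t (x + h *\<^sub>R \<xi>)) 0" "isCont (\<lambda>h. w t (y + h *\<^sub>R \<eta>')) 0"
      using w_line[OF t0] DERIV_isCont by blast+
    then have "isCont (\<lambda>h. w t (x + h *\<^sub>R \<xi>) - w t (y + h *\<^sub>R \<eta>')) 0" by (rule isCont_diff)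
    from this[unfolded isCont_def, THEN tendsto_at_iff_tendsto_nhds[where l = 0 and g = "\<lambda>h. w t (x + h *\<^sub>R \<xi>) - w t (y + h *\<^sub>R \<eta>')", THEN iffD1]]
    have "((\<lambda>h. w t (x + h *\<^sub>R \<xi>) - w t (y + h *\<^sub>R \<eta>')) \<longlongrightarrow> w t (x + 0 *\<^sub>R \<xi>) - w t (y + 0 *\<^sub>R \<eta>')) (nhds 0)" .
    then have ev1: "\<forall>\<^sub>F h in nhds 0. w t (x + h *\<^sub>R \<xi>) - w t (y + h *\<^sub>R \<eta>') > 0"
      by (rule order_tendstoD) (use st in simp)
    have "((\<lambda>h. y + h *\<^sub>R \<eta>') \<longlongrightarrow> y + 0 *\<^sub>R \<eta>') (nhds 0)" by (intro tendsto_intros filterlim_ident)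
    then have ev2: "\<forall>\<^sub>F h in nhds 0. y + h *\<^sub>R \<eta>' \<in> ball 0 R"
      by (rule topological_tendstoD) (use st in auto)
    have "open {z::'a. \<eta> < e (z \<bullet> z)}" by (intro open_Collect_less continuous_intros cont_e)
    moreover have "((\<lambda>h. x + h *\<^sub>R \<xi>) \<longlongrightarrow> x + 0 *\<^sub>R \<xi>) (nhds 0)" by (intro tendsto_intros filterlim_ident)
    ultimately have ev3: "\<forall>\<^sub>F h in nhds 0. x + h *\<^sub>R \<xi> \<in> {z. \<eta> < e (z \<bullet> z)}"
      by (intro topological_tendstoD) (use st in auto)
    from ev1 ev2 ev3 show ?thesis
    proof eventually_elim
      case (elim h)
      define x' y' where "x' = x + h *\<^sub>R \<xi>" and "y' = y + h *\<^sub>R \<eta>'"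
      have "(t, x', y') \<in> S" using elim tS by (auto simp: S_def x'_def y'_def)
      then have "\<Psi> (t, x', y') \<le> \<Psi> (t, x, y)" by (rule mx)
      moreover have "P t x' y' = w t x' - w t y'" using elim by (simp add: P_def x'_def y'_def)
      ultimately have "exp (- L * t) * ((w t x' - w t y')\<^sup>2 - M t (x' \<bullet> x') * ((x' - y') \<bullet> (x' - y')))
         \<le> exp (- L * t) * ((w t x - w t y)\<^sup>2 - M t (x \<bullet> x) * ((x - y) \<bullet> (x - y)))"
        by (simp add: \<Psi>_def Ptxy)
      then have "(w t x' - w t y')\<^sup>2 - M t (x' \<bullet> x') * ((x' - y') \<bullet> (x' - y'))
         \<le> (w t x - w t y)\<^sup>2 - M t (x \<bullet> x) * ((x - y) \<bullet> (x - y))"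
        by (subst (asm) mult_le_cancel_left_pos) auto
      moreover have "x' - y' = (x - y) + h *\<^sub>R (\<xi> - \<eta>')" by (simp add: x'_def y'_def algebra_simps)
      ultimately show ?case by (simp only: x'_def y'_def)
    qed
  qed
  define X Y where "X = w t x" and "Y = w t y"
  define wx where "wx = - \<gamma> * X\<^sup>2 * (\<Sum>b\<in>Basis. hess_w t x b) - (2 + \<gamma>) * X * (grad_w t x \<bullet> grad_w t x)"
  define wy where "wy = - \<gamma> * Y\<^sup>2 * (\<Sum>b\<in>Basis. hess_w t y b) - (2 + \<gamma>) * Y * (grad_w t y \<bullet> grad_w t y)"
  define D where "D = X - Y"
  have D: "D > 0" using st by (simp add: D_def X_def Y_def)
  define j where "j = 2 * M' \<rho> * (x \<bullet> v)"
  define lap where "lap = 4 * \<rho> * M'' + 2 * real DIM('a) * M' \<rho>"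
  have dwx: "((\<lambda>t. w t x) has_real_derivative wx) (at t)" and dwy: "((\<lambda>t. w t y) has_real_derivative wy) (at t)"
    unfolding wx_def wy_def X_def Y_def by (rule w_time[OF t0])+
  have space: "D * (wx - wy) \<le> - \<gamma> * (X\<^sup>2 * lap * r2 / 2 + 2 * X * D * j + M t \<rho> * DIM('a) * D\<^sup>2)
      - 2 * (M t \<rho>)\<^sup>2 * r2 - 2 * X * r2 * M t \<rho> * j / D"
    unfolding wx_def wy_def D_def \<rho>_def
    by (rule doubled_spatial_inequality[OF t0 _ \<rho>I dM dM' spatial])
      (use D in \<open>simp_all add: I_def X_def Y_def D_def r2_def v_def \<rho>_def j_def lap_def\<close>)
  \<comment> \<open>The time condition at the maximum: differentiating the exponential produces the
    term in \<open>L\<close>, and the decay of the weight produces the term with (t - s)^2. Only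
    earlier times are compared, since t may be T.\<close>
  have time: "2 * D * (wx - wy) + a / (t - s)\<^sup>2 / (e \<rho>)\<^sup>2 * r2 \<ge> L * \<zeta>"
  proof -
    define F where "F = (\<lambda>r. exp (- L * r) * ((w r x - w r y)\<^sup>2 - M r \<rho> * r2))"
    have dMt: "((\<lambda>r. M r \<rho>) has_real_derivative - (a / (t - s)\<^sup>2 / (e \<rho>)\<^sup>2)) (at t)"
    proof -
      have "((\<lambda>r. a / (r - s)) has_real_derivative - (a / (t - s)\<^sup>2)) (at t)"
        using tT by (auto intro!: derivative_eq_intros simp: power2_eq_square)
      from DERIV_cdivide[OF this, of "(e \<rho>)\<^sup>2"] show ?thesis by (simp add: M_def)
    qed
    have dF: "(F has_real_derivative exp (- L * t) * ((2 * D * (wx - wy) + a / (t - s)\<^sup>2 / (e \<rho>)\<^sup>2 * r2) - L * \<zeta>)) (at t)"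
      unfolding F_def
      by (auto intro!: derivative_eq_intros dwx dwy dMt simp: D_def X_def Y_def \<zeta>_def algebra_simps)
    have "((\<lambda>r. w r x - w r y) \<longlongrightarrow> w t x - w t y) (at_left t)"
      using DERIV_isCont[OF dwx] DERIV_isCont[OF dwy] unfolding isCont_def
      by (intro tendsto_diff) (auto intro: tendsto_within_subset)
    then have "\<forall>\<^sub>F r in at_left t. w r x - w r y > 0" by (rule order_tendstoD) (use st in simp)
    then obtain b where b: "b < t" "\<And>r. b < r \<Longrightarrow> r < t \<Longrightarrow> w r x - w r y > 0"
      unfolding eventually_at_left_field by blast
    have "exp (- L * t) * ((2 * D * (wx - wy) + a / (t - s)\<^sup>2 / (e \<rho>)\<^sup>2 * r2) - L * \<zeta>) \<ge> 0"
    proof (rule left_max_derivative_nonneg[OF dF])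
      show "max b (s + \<tau>0) < t" using b st by simp
      fix r assume r: "max b (s + \<tau>0) < r" "r < t"
      have "(r, x, y) \<in> S" using r tS by (auto simp: S_def)
      then have "\<Psi> (r, x, y) \<le> \<Psi> (t, x, y)" by (rule mx)
      moreover have "P r x y = w r x - w r y" using b r by (simp add: P_def)
      ultimately show "F r \<le> F t" by (simp add: \<Psi>_def F_def Ptxy \<rho>_def r2_def v_def)
    qed
    then show ?thesis by (simp add: zero_le_mult_iff)
  qed
  have rate: "- \<gamma> * (X\<^sup>2 * lap * r2 / 2 + 2 * X * D * j + M t \<rho> * DIM('a) * D\<^sup>2)
      - 2 * (M t \<rho>)\<^sup>2 * r2 - 2 * X * r2 * M t \<rho> * j / D + a / (t - s)\<^sup>2 / (e \<rho>)\<^sup>2 * r2 / 2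
    \<le> (8 * sqrt C * sqrt (a / (t - s)) / (e \<rho>)\<^sup>2 + real DIM('a) * M t \<rho>) * \<zeta>"
  proof (rule doubled_rate_bound[where T = T and \<mu> = \<mu> and c = c and \<rho> = \<rho> and ?M1.0 = "M' \<rho>" and ?M2.0 = M''])
    show "c = 4 - 2 * real DIM('a) * - \<gamma>" by (simp add: c)
    show "X\<^sup>2 \<le> C * (1 + \<rho>)" unfolding X_def w_sq \<rho>_def using tT by (intro growth) auto
    show "D\<^sup>2 = M t \<rho> * r2 + \<zeta>" by (simp add: \<zeta>_def D_def X_def Y_def)
    show "j\<^sup>2 \<le> 4 * (M' \<rho>)\<^sup>2 * \<rho> * r2"
    proof -
      have "j\<^sup>2 = 4 * (M' \<rho>)\<^sup>2 * (x \<bullet> v)\<^sup>2" by (simp add: j_def power_mult_distrib)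
      also have "\<dots> \<le> 4 * (M' \<rho>)\<^sup>2 * ((x \<bullet> x) * (v \<bullet> v))"
        by (intro mult_left_mono Cauchy_Schwarz_ineq) auto
      finally show ?thesis by (simp add: \<rho>_def r2_def)
    qed
    show "X \<ge> 0" using w_pos[OF t0, of x] by (simp add: X_def)
    show "(C * T * (24 + 4 * real DIM('a)) + 32 * sqrt (C * a * T)) * \<mu> \<le> c * a - 1" by (rule small)
  qed (use gamma gamma_bound C a tT s \<mu> ex e_le \<rho> D \<zeta> in \<open>auto simp: \<rho>_def[symmetric] M_def M'_def M''_def \<kappa>_def lap_def r2_def\<close>)
  have "L * \<zeta> / 2 \<le> (8 * sqrt C * sqrt (a / (t - s)) / (e \<rho>)\<^sup>2 + real DIM('a) * M t \<rho>) * \<zeta>"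
  proof -
    have "L * \<zeta> / 2 \<le> (2 * D * (wx - wy) + a / (t - s)\<^sup>2 / (e \<rho>)\<^sup>2 * r2) / 2"
      using time by (rule divide_right_mono) simp
    also have "\<dots> = D * (wx - wy) + a / (t - s)\<^sup>2 / (e \<rho>)\<^sup>2 * r2 / 2"
      by (simp add: add_divide_distrib)
    also note add_right_mono[OF space, of "a / (t - s)\<^sup>2 / (e \<rho>)\<^sup>2 * r2 / 2"]
    also note rate
    finally show ?thesis .
  qed
  also have "\<dots> \<le> (8 * sqrt C * \<Lambda> / \<eta>\<^sup>2 + real DIM('a) * \<Lambda>\<^sup>2) * \<zeta>"
  proof (intro mult_right_mono add_mono mult_left_mono)
    have "a / (t - s) \<le> \<Lambda>\<^sup>2"
      using st(1) \<Lambda> tT by (simp add: \<tau>0_def field_simps)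
    then have "sqrt (a / (t - s)) \<le> \<Lambda>" using \<Lambda> by (simp add: real_le_lsqrt)
    then show "8 * sqrt C * sqrt (a / (t - s)) / (e \<rho>)\<^sup>2 \<le> 8 * sqrt C * \<Lambda> / \<eta>\<^sup>2"
      using C \<eta> st(2) \<Lambda> by (intro frac_le mult_left_mono power_mono) (auto simp: \<rho>_def)
  qed (use \<zeta> st in \<open>auto simp: \<rho>_def\<close>)
  also have "\<dots> = (L - 1) / 2 * \<zeta>" by (simp add: L_def)
  finally show False using \<zeta> by (simp add: field_simps)
qed

section \<open>Removal of the cutoff and passage to the gradient\<close>

lemma w_difference_bound:
  assumes t: "t > 0" and y: "w t y \<le> w t x" and c: "c = 4 + 2 * real DIM('a) * \<gamma>"
  shows "(w t x - w t y)\<^sup>2 \<le> 1 / (c * t) * ((x - y) \<bullet> (x - y))"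
proof -
  have cpos: "c > 0" using gamma_bound by (simp add: c)
  have "(w t x - w t y)\<^sup>2 \<le> (1 / c + s) / (t - s) * ((x - y) \<bullet> (x - y))" if s: "0 < s" "s < t" for s
  proof -
    \<comment> \<open>One parameter serves twice: \<open>s\<close> is the starting time and provides
      the slack c a - 1 = c s. Since the growth constant depends on \<open>s\<close>, the cutoff is
      removed first, by \<mu> tending to 0, and only then does \<open>s\<close> tend to 0.\<close>
    define a where "a = 1 / c + s"
    have a: "a > 0" using cpos s by (simp add: a_def add_pos_pos)
    have ca: "c * a - 1 > 0" using cpos s by (simp add: a_def distrib_left)
    obtain C where C: "C > 0" "\<And>r z. s \<le> r \<Longrightarrow> r \<le> t \<Longrightarrow> n r z powr \<gamma> \<le> C * (1 + z \<bullet> z)"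
      using quadratic_growth[OF s(1), of t] by auto
    define l where "l = ln (1 + x \<bullet> x)"
    define E where "E = C * t * (24 + 4 * real DIM('a)) + 32 * sqrt (C * a * t)"
    have lim: "((\<lambda>\<mu>. \<mu> * l) \<longlongrightarrow> 0 * l) (at_right 0)" "((\<lambda>\<mu>. E * \<mu>) \<longlongrightarrow> E * 0) (at_right 0)"
      by (intro tendsto_intros)+
    have "\<forall>\<^sub>F \<mu> in at_right 0. \<mu> * l < 1" "\<forall>\<^sub>F \<mu> in at_right 0. E * \<mu> < c * a - 1"
      using order_tendstoD(2)[OF lim(1), of 1] order_tendstoD(2)[OF lim(2), of "c * a - 1"] ca by auto
    moreover have "\<forall>\<^sub>F \<mu> in at_right 0. \<mu> \<in> {0<..<1::real}"
      by (rule eventually_at_right_real) simp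
    ultimately have "\<forall>\<^sub>F \<mu> in at_right 0. (w t x - w t y)\<^sup>2 \<le> a / (t - s) / (1 - \<mu> * l)\<^sup>2 * ((x - y) \<bullet> (x - y))"
    proof eventually_elim
      case (elim \<mu>)
      show ?case unfolding l_def
        by (rule doubling_estimate[OF s(1) C a _ _ c, where T = t])
          (use elim s y in \<open>auto simp: l_def E_def\<close>)
    qed
    moreover have "((\<lambda>\<mu>. a / (t - s) / (1 - \<mu> * l)\<^sup>2 * ((x - y) \<bullet> (x - y)))
        \<longlongrightarrow> a / (t - s) / (1 - 0 * l)\<^sup>2 * ((x - y) \<bullet> (x - y))) (at_right 0)"
      by (intro tendsto_intros) auto
    ultimately have "(w t x - w t y)\<^sup>2 \<le> a / (t - s) / (1 - 0 * l)\<^sup>2 * ((x - y) \<bullet> (x - y))"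
      by (intro tendsto_lowerbound) auto
    then show ?thesis by (simp add: a_def)
  qed
  moreover have "\<forall>\<^sub>F s in at_right 0. s \<in> {0<..<t}" by (rule eventually_at_right_real) (rule t)
  ultimately have "\<forall>\<^sub>F s in at_right 0. (w t x - w t y)\<^sup>2 \<le> (1 / c + s) / (t - s) * ((x - y) \<bullet> (x - y))"
    by (auto elim: eventually_mono)
  moreover have "((\<lambda>s. (1 / c + s) / (t - s) * ((x - y) \<bullet> (x - y)))
     \<longlongrightarrow> (1 / c + 0) / (t - 0) * ((x - y) \<bullet> (x - y))) (at_right 0)"
    by (intro tendsto_intros) (use t in auto)
  ultimately have "(w t x - w t y)\<^sup>2 \<le> (1 / c + 0) / (t - 0) * ((x - y) \<bullet> (x - y))"
    by (intro tendsto_lowerbound) auto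
  then show ?thesis by simp
qed

text \<open>The difference bound applies with x as the higher point, so the displacement is taken
  along the direction of steepest descent, where the difference quotient tends to the length of the
  gradient.\<close>

lemma grad_w_bound:
  assumes t: "t > 0" and c: "c = 4 + 2 * real DIM('a) * \<gamma>"
  shows "(norm (grad_w t x))\<^sup>2 \<le> 1 / (c * t)"
proof (rule ccontr)
  define p where "p = grad_w t x"
  define B where "B = sqrt (1 / (c * t))"
  have cpos: "c > 0" using gamma_bound by (simp add: c)
  have B: "B > 0" "B\<^sup>2 = 1 / (c * t)" using cpos t by (auto simp: B_def)
  assume "\<not> ?thesis"
  then have "B\<^sup>2 < (norm p)\<^sup>2" by (simp add: B(2) p_def)
  then have pB: "B < norm p" by (rule power_less_imp_less_base) simp
  define g where "g = (\<lambda>h. w t x - w t (x + h *\<^sub>R (- p)) - B * norm p * h)"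
  have "(g has_real_derivative - ((- p) \<bullet> grad_w t (x + 0 *\<^sub>R (- p))) - B * norm p) (at 0)"
  proof -
    have "((\<lambda>h. B * norm p * h) has_real_derivative B * norm p) (at 0)"
      by (auto intro!: derivative_eq_intros)
    from DERIV_diff[OF DERIV_diff[OF DERIV_const w_line[OF t, of x "- p" 0]] this, of "w t x"] show ?thesis
      unfolding g_def by simp
  qed
  moreover have "- ((- p) \<bullet> grad_w t (x + 0 *\<^sub>R (- p))) - B * norm p = (norm p - B) * norm p"
    by (simp add: p_def[symmetric] power2_eq_square algebra_simps flip: power2_norm_eq_inner)
  moreover have "(norm p - B) * norm p > 0" using pB B by (intro mult_pos_pos) auto
  ultimately obtain e where e: "e > 0" "\<And>h. 0 < h \<Longrightarrow> h < e \<Longrightarrow> g 0 < g (0 + h)"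
    using DERIV_pos_inc_right[of g _ 0] by metis
  define h where "h = e / 2"
  have h: "h > 0" "h < e" using e by (auto simp: h_def)
  define y where "y = x + h *\<^sub>R (- p)"
  have D: "B * norm p * h < w t x - w t y" using e(2)[OF h] by (simp add: g_def y_def)
  have nn: "B * norm p * h \<ge> 0" using B h by simp
  have "(B * norm p * h)\<^sup>2 < (w t x - w t y)\<^sup>2" using D nn by (intro power_strict_mono) auto
  also have "\<dots> \<le> 1 / (c * t) * ((x - y) \<bullet> (x - y))"
    using D nn by (intro w_difference_bound t c) auto
  also have "\<dots> = (B * norm p * h)\<^sup>2"
    by (simp add: y_def B(2)[symmetric] power_mult_distrib power2_eq_square flip: power2_norm_eq_inner)
  finally show False by simp
qed

end

text \<open>Since c = 2/\<alpha>, the bound 1/(c t) for |\<nabla>w|^2 equals \<alpha>/(2 t). The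
  sharp constant 2 \<alpha> belongs to |\<nabla>p|^2 / |p| = 4 |\<nabla>w|^2; for the gradient of
  the square root itself the stated bound then holds with a factor 4 to spare.\<close>

lemma cauchy_solution_gradient_bounds:
  fixes n :: "real \<Rightarrow> 'a::euclidean_space \<Rightarrow> real"
  assumes dim: "DIM('a::euclidean_space) \<ge> 2"
    and gamma: "- 2 / real DIM('a) < \<gamma>" "\<gamma> < 0"
    and alpha: "\<alpha> = 1 / (real DIM('a) * \<gamma> + 2)"
    and sol: "cauchy_solution \<gamma> n0 n" and t: "t > 0"
  shows "(\<lambda>y. sqrt \<bar>pressure \<gamma> n t y\<bar>) differentiable (at x)"
    and "(norm (grad (\<lambda>y. sqrt \<bar>pressure \<gamma> n t y\<bar>) x))\<^sup>2 \<le> 2 * \<alpha> / t"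
    and "(norm (grad (pressure \<gamma> n t) x))\<^sup>2 / \<bar>pressure \<gamma> n t x\<bar> \<le> 2 * \<alpha> / t"
proof -
  interpret fast_diffusion n \<gamma> "\<lambda>t. grad (n t)" "\<lambda>t x. frechet_derivative (grad (n t)) (at x)"
    by (rule cauchy_solution_imp_fast_diffusion[OF dim gamma sol])
  define c where "c = 4 + 2 * real DIM('a) * \<gamma>"
  have cpos: "c > 0" using gamma_bound by (simp add: c_def)
  have bound: "(norm (grad_w t x))\<^sup>2 \<le> 1 / (c * t)" by (rule grad_w_bound[OF t c_def])
  have "\<alpha> = 2 / c"
  proof -
    have "c = 2 * (real DIM('a) * \<gamma> + 2)" by (simp add: c_def)
    then show ?thesis unfolding alpha by (simp only: divide_divide_eq_left[symmetric])
  qed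
  then have \<alpha>: "2 * \<alpha> / t = 4 * (1 / (c * t))" by simp
  have w: "(\<lambda>y. sqrt \<bar>pressure \<gamma> n t y\<bar>) = w t"
  proof
    fix y
    have "\<bar>pressure \<gamma> n t y\<bar> = (w t y)\<^sup>2" by (simp add: pressure_def w_sq)
    then show "sqrt \<bar>pressure \<gamma> n t y\<bar> = w t y" using w_pos[OF t, of y] by simp
  qed
  show "(\<lambda>y. sqrt \<bar>pressure \<gamma> n t y\<bar>) differentiable (at x)"
    unfolding w using has_derivative_w[OF t] by (rule differentiableI)
  have "grad (w t) x = grad_w t x" by (rule has_derivative_imp_grad[OF has_derivative_w[OF t]])
  moreover have "1 / (c * t) \<le> 4 * (1 / (c * t))" using cpos t by (intro order_trans[OF _ mult_right_mono[of 1 4]]) auto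
  ultimately show "(norm (grad (\<lambda>y. sqrt \<bar>pressure \<gamma> n t y\<bar>) x))\<^sup>2 \<le> 2 * \<alpha> / t"
    unfolding w \<alpha> using bound by simp
  have N: "n t x > 0" by (rule pos[OF t])
  have "n t x powr (\<gamma> - 1) = w t x * n t x powr (\<gamma> / 2 - 1)"
    by (simp add: w_def flip: powr_add)
  then have "grad (pressure \<gamma> n t) x = (- 2 * w t x) *\<^sub>R grad_w t x"
    using has_derivative_grad_pressure[where n = n and t = t, OF deriv_n[OF t] N, of \<gamma>] by (simp add: grad_w_def)
  then have "(norm (grad (pressure \<gamma> n t) x))\<^sup>2 = 4 * (w t x)\<^sup>2 * (norm (grad_w t x))\<^sup>2"
    by (simp add: power_mult_distrib)
  moreover have "\<bar>pressure \<gamma> n t x\<bar> = (w t x)\<^sup>2" by (simp add: pressure_def w_sq)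
  ultimately have "(norm (grad (pressure \<gamma> n t) x))\<^sup>2 / \<bar>pressure \<gamma> n t x\<bar> = 4 * (norm (grad_w t x))\<^sup>2"
    using w_pos[OF t, of x] by simp
  then show "(norm (grad (pressure \<gamma> n t) x))\<^sup>2 / \<bar>pressure \<gamma> n t x\<bar> \<le> 2 * \<alpha> / t"
    unfolding \<alpha> using bound by simp
qed

section \<open>Barenblatt solutions\<close>

text \<open>Dyadic domination: the function lies below a series of multiples of indicators of balls
  of radius 2^k, whose integrals form a geometric series of ratio 2^(2 \<beta> + d). The hypothesis
  says that this ratio is below 1.\<close>

lemma integrable_powr_one_plus_norm_sq:
  assumes "\<beta> < - real DIM('a::euclidean_space) / 2"
  shows "integrable lborel (\<lambda>x::'a. (1 + x \<bullet> x) powr \<beta>)"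
proof -
  define q where "q = (2::real) powr (2 * \<beta> + DIM('a))"
  define V where "V = unit_ball_vol (real DIM('a))"
  \<comment> \<open>If k > 0 is the least index with |x| < 2^k, then |x| is at least 2^(k-1), whence
    the exponent k - 1. For k = 0 the coefficient exceeds 1, which suffices on the unit
    ball.\<close>
  define f where "f = (\<lambda>k (x::'a). 4 powr (\<beta> * (real k - 1)) * indicator (ball 0 (2 ^ k)) x)"
  have \<beta>: "\<beta> < 0" using assms by (simp add: field_simps)
  have q: "0 < q" "q < 1" using assms by (auto simp: q_def powr_less_one)
  have c: "4 powr (\<beta> * (real k - 1)) = 4 powr (- \<beta>) * (4 powr \<beta>) ^ k" for k
  proof -
    have "4 powr (\<beta> * (real k - 1)) = 4 powr (- \<beta> + \<beta> * real k)" by (simp add: algebra_simps)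
    then show ?thesis by (simp only: powr_add powr_powr[symmetric] powr_realpow powr_gt_zero)
  qed
  have b4: "4 powr \<beta> < (1::real)" using \<beta> by (simp add: powr_less_one)
  have sc: "summable (\<lambda>k. 4 powr (\<beta> * (real k - 1)))"
    unfolding c using b4 by (intro summable_mult summable_geometric) simp
  have pt: "summable (\<lambda>k. norm (f k x))" for x
    by (rule summable_comparison_test[OF _ sc]) (auto simp: f_def indicator_def)
  have "integrable lborel (\<lambda>x. \<Sum>k. f k x)"
  proof (rule integrable_suminf)
    show "integrable lborel (f k)" for k
      using emeasure_lborel_ball_finite[of "0::'a" "2 ^ k"] unfolding f_def
      by (intro integrable_mult_right integrable_real_indicator) auto
    show "AE x in lborel. summable (\<lambda>k. norm (f k x))" using pt by simp
    have "(\<integral>x. norm (f k x) \<partial>lborel) = 4 powr (- \<beta>) * V * q ^ k" for k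
    proof -
      have "(\<integral>x. norm (f k x) \<partial>lborel) = (\<integral>x. 4 powr (\<beta> * (real k - 1)) * indicator (ball 0 (2 ^ k)) (x::'a) \<partial>lborel)"
        by (intro Bochner_Integration.integral_cong) (auto simp: f_def indicator_def)
      also have "\<dots> = 4 powr (\<beta> * (real k - 1)) * measure lborel (ball (0::'a) (2 ^ k))"
        by simp
      also have "measure lborel (ball (0::'a) (2 ^ k)) = V * (2 ^ k) ^ DIM('a)"
        by (simp add: content_ball V_def)
      also have "4 powr (\<beta> * (real k - 1)) * (V * (2 ^ k) ^ DIM('a)) = 4 powr (- \<beta>) * V * (4 powr \<beta> * 2 ^ DIM('a)) ^ k"
        unfolding c by (simp add: power_mult_distrib mult_ac flip: power_mult)
      also have "4 powr \<beta> * 2 ^ DIM('a) = q"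
      proof -
        have "(4::real) powr \<beta> = (2 powr 2) powr \<beta>" by simp
        also have "\<dots> = 2 powr (2 * \<beta>)" by (rule powr_powr)
        finally show ?thesis by (simp add: q_def powr_add powr_realpow)
      qed
      finally show ?thesis .
    qed
    then show "summable (\<lambda>k. \<integral>x. norm (f k x) \<partial>lborel)"
      using q by (simp add: summable_mult summable_geometric)
  qed
  then show ?thesis
  proof (rule Bochner_Integration.integrable_bound)
    show "(\<lambda>x::'a. (1 + x \<bullet> x) powr \<beta>) \<in> borel_measurable lborel" by measurable
    have "(1 + x \<bullet> x) powr \<beta> \<le> (\<Sum>k. f k x)" for x :: 'a
    proof -
      define k where "k = (LEAST k. norm x < 2 ^ k)"
      have "\<exists>k. norm x < 2 ^ k" by (rule real_arch_pow) simp
      then have k: "norm x < 2 ^ k" unfolding k_def by (rule LeastI_ex)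
      have "(1 + x \<bullet> x) powr \<beta> \<le> f k x"
      proof (cases k)
        case 0
        have "(1 + x \<bullet> x) powr \<beta> \<le> 1 powr \<beta>" using \<beta> by (intro powr_mono2') auto
        also have "\<dots> \<le> 4 powr (- \<beta>)" using \<beta> by (simp add: ge_one_powr_ge_zero)
        finally show ?thesis using k 0 by (simp add: f_def)
      next
        case (Suc i)
        have "\<not> norm x < 2 ^ i" by (rule not_less_Least) (simp add: k_def[symmetric] Suc)
        then have "(2 ^ i)\<^sup>2 \<le> (norm x)\<^sup>2" by (intro power_mono) auto
        also have "(norm x)\<^sup>2 = x \<bullet> x" by (rule power2_norm_eq_inner)
        finally have "(2 ^ i)\<^sup>2 \<le> x \<bullet> x" .
        moreover have "(2 ^ i)\<^sup>2 = (4::real) ^ i" by (simp add: power2_eq_square flip: power_mult_distrib)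
        ultimately have "4 ^ i \<le> 1 + x \<bullet> x" by simp
        then have "(1 + x \<bullet> x) powr \<beta> \<le> (4 ^ i) powr \<beta>" using \<beta> by (intro powr_mono2') auto
        also have "\<dots> = 4 powr (\<beta> * (real k - 1))"
        proof -
          have "(4::real) ^ i = 4 powr real i" by (simp add: powr_realpow)
          then show ?thesis by (simp add: powr_powr Suc mult.commute)
        qed
        finally show ?thesis using k by (simp add: f_def)
      qed
      also have "f k x = (\<Sum>i\<in>{k}. f i x)" by simp
      also have "\<dots> \<le> (\<Sum>k. f k x)"
        by (rule sum_le_suminf) (use summable_norm_cancel[OF pt[of x]] in \<open>auto simp: f_def\<close>)
      finally show ?thesis .
    qed
    then show "AE x in lborel. norm ((1 + x \<bullet> x) powr \<beta>) \<le> norm (\<Sum>k. f k x)"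
      by (intro AE_I2) (simp add: order_trans[OF _ abs_ge_self])
  qed
qed

text \<open>The origin of time is shifted by \<open>1\<close> to make the initial datum integrable; the loss from
  \<open>1/t\<close> to \<open>1/(t + 1)\<close> disappears for large \<open>t\<close>.\<close>

definition barenblatt_pressure :: "real \<Rightarrow> real \<Rightarrow> 'a::euclidean_space \<Rightarrow> real" where
  "barenblatt_pressure \<gamma> t x =
     (t + 1) powr (- real DIM('a) * \<gamma> / (real DIM('a) * \<gamma> + 2)) + x \<bullet> x / (2 * (real DIM('a) * \<gamma> + 2) * (t + 1))"

definition barenblatt :: "real \<Rightarrow> real \<Rightarrow> 'a::euclidean_space \<Rightarrow> real" where
  "barenblatt \<gamma> t x = barenblatt_pressure \<gamma> t x powr (1 / \<gamma>)"

text \<open>For a pressure of absolute value A(t) + B(t) |x|^2 the equation separates by powers of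
  |x| into B' = -2 q B^2 and A' = -2 d \<gamma> B A with q = d \<gamma> + 2. The range of \<gamma>
  amounts to 1/\<gamma> < -d/2, the decay that makes the density integrable.\<close>

lemma barenblatt_solution:
  fixes \<gamma> :: real
  assumes gamma: "- 2 / real DIM('a::euclidean_space) < \<gamma>" "\<gamma> < 0"
  shows "cauchy_solution \<gamma> (barenblatt \<gamma> 0) (barenblatt \<gamma> :: real \<Rightarrow> 'a \<Rightarrow> real)"
    and "integrable lborel (barenblatt \<gamma> 0 :: 'a \<Rightarrow> real)"
    and "t > 0 \<Longrightarrow> pressure \<gamma> (barenblatt \<gamma>) t x = - barenblatt_pressure \<gamma> t (x :: 'a)"
    and "t > 0 \<Longrightarrow> grad (pressure \<gamma> (barenblatt \<gamma>) t) (x :: 'a) = (- 1 / ((real DIM('a) * \<gamma> + 2) * (t + 1))) *\<^sub>R x"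
proof -
  define d where "d = real DIM('a)"
  define q where "q = d * \<gamma> + 2"
  define \<beta> where "\<beta> = 1 / \<gamma>"
  have d: "d > 0" by (simp add: d_def)
  have q: "q > 0" using gamma d by (simp add: q_def d_def[symmetric] field_simps)
  have \<beta>: "\<beta> < - d / 2"
  proof -
    have "\<gamma> * d > -2" using q by (simp add: q_def mult.commute)
    then show ?thesis using gamma d by (simp add: \<beta>_def field_simps)
  qed
  have \<beta>neg: "\<beta> < 0" using gamma by (simp add: \<beta>_def)
  have \<gamma>\<beta>: "\<gamma> * \<beta> = 1" using gamma by (simp add: \<beta>_def)
  define A where "A = (\<lambda>t. (t + 1) powr (- d * \<gamma> / q))"
  define B where "B = (\<lambda>t. 1 / (2 * q * (t + 1)))"
  define U where "U = (\<lambda>t (x::'a). A t + B t * (x \<bullet> x))"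
  let ?n = "barenblatt \<gamma> :: real \<Rightarrow> 'a \<Rightarrow> real"
  have U_eq: "barenblatt_pressure \<gamma> = U"
    by (intro ext) (simp add: barenblatt_pressure_def U_def A_def B_def d_def q_def)
  have n_eq: "?n t x = U t x powr \<beta>" for t x
    by (simp add: barenblatt_def U_eq \<beta>_def)
  have Apos: "A t > 0" and Bpos: "B t > 0" if "t \<ge> 0" for t
    using that q by (auto simp: A_def B_def)
  have U: "U t x > 0" if "t \<ge> 0" for t x
    using Apos[OF that] Bpos[OF that] by (simp add: U_def add_pos_nonneg)
  have npos: "?n t x > 0" if "t \<ge> 0" for t x
    using U[OF that, of x] by (simp add: n_eq)
  have n\<gamma>: "?n t x powr \<gamma> = U t x" if "t \<ge> 0" for t x
    using U[OF that, of x] \<gamma>\<beta> by (simp add: n_eq powr_powr mult.commute)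
  have dU: "(U t has_derivative (\<lambda>h. 2 * B t * (h \<bullet> x))) (at x)" for t x
    unfolding U_def by (auto intro!: derivative_eq_intros simp: inner_commute algebra_simps)
  define g where "g = (\<lambda>t (x::'a). (\<beta> * U t x powr (\<beta> - 1) * (2 * B t)) *\<^sub>R x)"
  define H where "H = (\<lambda>t (x::'a) h. (\<beta> * U t x powr (\<beta> - 1) * (2 * B t)) *\<^sub>R h
     + (\<beta> * ((\<beta> - 1) * U t x powr (\<beta> - 2) * (2 * B t * (h \<bullet> x))) * (2 * B t)) *\<^sub>R x)"
  have dn: "(?n t has_derivative (\<lambda>h. h \<bullet> g t x)) (at x)" if "t \<ge> 0" for t x
  proof -
    have "?n t = (\<lambda>x. U t x powr \<beta>)" by (intro ext n_eq)
    then show ?thesis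
      using has_derivative_powr_const[OF dU U[OF that], where r = \<beta> and x = x] by (simp add: g_def mult_ac)
  qed
  have dg: "(g t has_derivative H t x) (at x)" if "t \<ge> 0" for t x
  proof -
    have "((\<lambda>x. \<beta> * U t x powr (\<beta> - 1) * (2 * B t)) has_derivative
        (\<lambda>h. \<beta> * ((\<beta> - 1) * U t x powr (\<beta> - 1 - 1) * (2 * B t * (h \<bullet> x))) * (2 * B t))) (at x)"
      by (intro has_derivative_mult_left has_derivative_mult_right has_derivative_powr_const dU U that)
    from has_derivative_scaleR[OF this has_derivative_ident] show ?thesis
      unfolding g_def H_def by simp
  qed
  have gradn: "grad (?n t) = g t" if "t \<ge> 0" for t
    by (intro ext has_derivative_imp_grad dn that)
  have gradp: "grad (pressure \<gamma> ?n t) x = (- 2 * B t) *\<^sub>R x" if "t \<ge> 0" for t x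
  proof -
    \<comment> \<open>Since \<gamma> \<beta> = 1, the exponents \<beta> (\<gamma> - 1) and \<beta> -
      1 of \<open>U\<close> cancel, which makes the pressure gradient linear in x.\<close>
    have e1: "?n t x powr (\<gamma> - 1) * U t x powr (\<beta> - 1) = 1"
    proof -
      have "?n t x powr (\<gamma> - 1) = U t x powr (1 - \<beta>)"
        using \<gamma>\<beta> by (simp add: n_eq powr_powr algebra_simps)
      then show ?thesis using U[OF that, of x] by (simp flip: powr_add)
    qed
    have "grad (pressure \<gamma> ?n t) x = (- \<gamma> * ?n t x powr (\<gamma> - 1)) *\<^sub>R g t x"
      by (rule has_derivative_grad_pressure[where n = ?n and t = t, OF dn[OF that] npos[OF that]])
    also have "\<dots> = (- 2 * ((\<gamma> * \<beta>) * (?n t x powr (\<gamma> - 1) * U t x powr (\<beta> - 1))) * B t) *\<^sub>R x"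
      by (simp add: g_def mult_ac)
    also have "\<dots> = (- 2 * B t) *\<^sub>R x" unfolding e1 \<gamma>\<beta> by simp
    finally show ?thesis .
  qed
  define nt where "nt = (\<lambda>t x. \<beta> * U t x powr (\<beta> - 1) * (- 2 * d * \<gamma> * B t * A t - 2 * q * (B t)\<^sup>2 * (x \<bullet> x)))"
  have dt: "((\<lambda>s. ?n s x) has_real_derivative nt t x) (at t)" if t: "t > 0" for t x
  proof -
    have "(A has_real_derivative - d * \<gamma> / q * (t + 1) powr (- d * \<gamma> / q - 1)) (at t)"
      unfolding A_def using t by (auto intro!: derivative_eq_intros has_real_derivative_powr[THEN DERIV_chain2])
    moreover have "- d * \<gamma> / q * (t + 1) powr (- d * \<gamma> / q - 1) = - 2 * d * \<gamma> * B t * A t"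
      using t q by (simp add: A_def B_def powr_diff)
    moreover have "(B has_real_derivative - 2 * q * (B t)\<^sup>2) (at t)"
    proof -
      have "(B has_real_derivative - (2 * q) / (2 * q * (t + 1))\<^sup>2) (at t)"
        unfolding B_def using t q by (auto intro!: derivative_eq_intros simp: power2_eq_square)
      then show ?thesis by (simp add: B_def power_divide)
    qed
    ultimately have "((\<lambda>s. U s x) has_real_derivative - 2 * d * \<gamma> * B t * A t - 2 * q * (B t)\<^sup>2 * (x \<bullet> x)) (at t)"
      unfolding U_def by (auto intro!: derivative_eq_intros)
    from DERIV_chain2[OF has_real_derivative_powr this, of \<beta>] show ?thesis
      using U[of t x] t by (simp add: nt_def n_eq)
  qed
  have cA: "continuous_on ({0<..} \<times> UNIV) (\<lambda>z::real \<times> 'a. A (fst z))"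
    and cB: "continuous_on ({0<..} \<times> UNIV) (\<lambda>z::real \<times> 'a. B (fst z))"
    unfolding A_def B_def using q by (auto intro!: continuous_intros)
  have cU: "continuous_on ({0<..} \<times> UNIV) (\<lambda>z::real \<times> 'a. U (fst z) (snd z))"
    unfolding U_def by (intro continuous_intros cA cB)
  have cUp: "continuous_on ({0<..} \<times> UNIV) (\<lambda>z::real \<times> 'a. U (fst z) (snd z) powr r)" for r
  proof (rule continuous_on_powr[OF cU continuous_on_const], rule ballI)
    fix z :: "real \<times> 'a" assume "z \<in> {0<..} \<times> UNIV"
    then show "U (fst z) (snd z) \<noteq> 0" using U[of "fst z" "snd z"] by auto
  qed
  have C12: "C12 ?n"
    unfolding C12_def
  proof (intro conjI allI impI)
    fix t :: real and x :: 'a assume t: "t > 0"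
    show "(\<lambda>s. ?n s x) differentiable (at t)"
      using dt[OF t, of x] real_differentiable_def by blast
    show "?n t differentiable (at x)" by (rule differentiableI[OF dn]) (use t in simp)
    show "grad (?n t) differentiable (at x)" using dg[of t x] t gradn[of t] by (auto intro: differentiableI)
  next
    show "continuous_on ({0<..} \<times> UNIV) (\<lambda>(t, x). ?n t x)"
      unfolding split_def n_eq by (rule cUp)
    have "continuous_on ({0<..} \<times> UNIV) (\<lambda>z::real \<times> 'a. nt (fst z) (snd z))"
      unfolding nt_def by (intro continuous_intros cUp cA cB)
    then show "continuous_on ({0<..} \<times> UNIV) (\<lambda>(t, x). deriv (\<lambda>s. ?n s x) t)"
      by (rule continuous_on_eq) (use DERIV_imp_deriv[OF dt] in auto)
    have "continuous_on ({0<..} \<times> UNIV) (\<lambda>z::real \<times> 'a. g (fst z) (snd z))"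
      unfolding g_def by (intro continuous_intros cUp cB)
    then show "continuous_on ({0<..} \<times> UNIV) (\<lambda>(t, x). grad (?n t) x)"
      by (rule continuous_on_eq) (use gradn in auto)
    fix v
    have "continuous_on ({0<..} \<times> UNIV) (\<lambda>z::real \<times> 'a. H (fst z) (snd z) v)"
      unfolding H_def by (intro continuous_intros cUp cB)
    then show "continuous_on ({0<..} \<times> UNIV) (\<lambda>(t, x). frechet_derivative (grad (?n t)) (at x) v)"
      by (rule continuous_on_eq) (use gradn frechet_derivative_at[OF dg] in auto)
  qed
  have pde: "nt t x = divergence (\<lambda>y. ?n t y *\<^sub>R grad (pressure \<gamma> ?n t) y) x" if t: "t > 0" for t x
  proof -
    have "((\<lambda>y. ?n t y *\<^sub>R ((- 2 * B t) *\<^sub>R y)) has_derivative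
        (\<lambda>h. ?n t x *\<^sub>R ((- 2 * B t) *\<^sub>R h) + (h \<bullet> g t x) *\<^sub>R ((- 2 * B t) *\<^sub>R x))) (at x)"
      by (intro has_derivative_scaleR has_derivative_scaleR_right has_derivative_ident dn) (use t in simp)
    moreover have "(\<lambda>y. ?n t y *\<^sub>R grad (pressure \<gamma> ?n t) y) = (\<lambda>y. ?n t y *\<^sub>R ((- 2 * B t) *\<^sub>R y))"
      using gradp t by simp
    ultimately have "divergence (\<lambda>y. ?n t y *\<^sub>R grad (pressure \<gamma> ?n t) y) x
        = (\<Sum>b\<in>Basis. (?n t x *\<^sub>R ((- 2 * B t) *\<^sub>R b) + (b \<bullet> g t x) *\<^sub>R ((- 2 * B t) *\<^sub>R x)) \<bullet> b)"
      by (simp only: has_derivative_imp_divergence)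
    also have "\<dots> = (\<Sum>b\<in>(Basis::'a set). - 2 * B t * ?n t x + - 2 * B t * ((b \<bullet> g t x) * (b \<bullet> x)))"
    proof (rule sum.cong)
      fix b :: 'a assume "b \<in> Basis"
      then have "b \<bullet> b = 1" by (simp add: inner_Basis)
      then show "(?n t x *\<^sub>R ((- 2 * B t) *\<^sub>R b) + (b \<bullet> g t x) *\<^sub>R ((- 2 * B t) *\<^sub>R x)) \<bullet> b
        = - 2 * B t * ?n t x + - 2 * B t * ((b \<bullet> g t x) * (b \<bullet> x))"
        by (simp add: inner_add_left inner_diff_left inner_commute[of x b])
    qed simp
    also have "\<dots> = - 2 * B t * (d * ?n t x + g t x \<bullet> x)"
      by (simp only: sum.distrib sum_constant d_def sum_Basis_inner_prod flip: sum_distrib_left)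
        (simp add: algebra_simps)
    also have "\<dots> = - 2 * B t * (d * (U t x * U t x powr (\<beta> - 1)) + \<beta> * U t x powr (\<beta> - 1) * (2 * B t) * (x \<bullet> x))"
      using U[of t x] t by (simp add: n_eq g_def powr_diff)
    \<comment> \<open>Inserting \<gamma> \<beta> = 1 into the first summand lets \<beta> be factored
      out, as in \<open>nt\<close>.\<close>
    also have "\<dots> = - 2 * B t * U t x powr (\<beta> - 1) * (d * (\<gamma> * \<beta>) * U t x + \<beta> * (2 * B t) * (x \<bullet> x))"
      unfolding \<gamma>\<beta> by (simp add: algebra_simps)
    also have "\<dots> = nt t x"
      unfolding nt_def U_def q_def by (simp add: algebra_simps power2_eq_square)
    finally show ?thesis ..
  qed
  \<comment> \<open>\<open>A\<close> is at least 1 and \<open>B\<close> decreases, so the lower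
    bound is uniform in time. As \<beta> is negative, it gives an integrable majorant of the
    density, used for integrability and for dominated convergence at time 0.\<close>
  have bound: "\<exists>m>0. \<forall>t\<in>{a..b}. \<forall>x. m * (1 + x \<bullet> x) \<le> U t x" if ab: "0 \<le> a" "a \<le> b" for a b
  proof -
    define m where "m = min 1 (B b)"
    have m: "m > 0" "m \<le> 1" "m \<le> B b" using Bpos[of b] ab by (auto simp: m_def)
    have "m * (1 + x \<bullet> x) \<le> U t x" if t: "t \<in> {a..b}" for t x
    proof -
      have "- d * \<gamma> / q \<ge> 0" using d q gamma by (simp add: divide_nonpos_pos mult_nonneg_nonpos)
      then have "A t \<ge> 1" using t ab unfolding A_def by (intro ge_one_powr_ge_zero) auto
      moreover have "B t \<ge> B b" using t ab q unfolding B_def by (intro divide_left_mono) auto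
      ultimately have "m \<le> A t" "m * (x \<bullet> x) \<le> B t * (x \<bullet> x)" using m by (auto intro: mult_right_mono)
      then show ?thesis by (simp add: U_def distrib_left)
    qed
    then show ?thesis using m by blast
  qed
  have nbound: "\<exists>K. \<forall>t\<in>{a..b}. \<forall>x. ?n t x \<le> K * (1 + x \<bullet> x) powr \<beta>" if ab: "0 \<le> a" "a \<le> b" for a b
  proof -
    obtain m where m: "m > 0" "\<And>t x. t \<in> {a..b} \<Longrightarrow> m * (1 + x \<bullet> x) \<le> U t x" using bound[OF ab] by blast
    have "?n t x \<le> m powr \<beta> * (1 + x \<bullet> x) powr \<beta>" if "t \<in> {a..b}" for t x
    proof -
      have "?n t x \<le> (m * (1 + x \<bullet> x)) powr \<beta>"
        unfolding n_eq using m that \<beta>neg by (intro powr_mono2') (auto simp: add_pos_nonneg)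
      then show ?thesis using m by (simp add: powr_mult)
    qed
    then show ?thesis by blast
  qed
  have meas: "?n t \<in> borel_measurable lborel" for t
    unfolding n_eq[abs_def] U_def by measurable
  have base: "integrable lborel (\<lambda>x::'a. (1 + x \<bullet> x) powr \<beta>)"
    using \<beta> by (intro integrable_powr_one_plus_norm_sq) (simp add: d_def)
  have int: "integrable lborel (?n t)" if t: "t \<ge> 0" for t
  proof -
    obtain K where K: "\<And>x. ?n t x \<le> K * (1 + x \<bullet> x) powr \<beta>" using nbound[OF t order_refl] by auto
    show ?thesis
    proof (rule Bochner_Integration.integrable_bound[OF integrable_mult_right[OF base, of K] meas])
      show "AE x in lborel. norm (?n t x) \<le> norm (K * (1 + x \<bullet> x) powr \<beta>)"
        using K npos[OF t] by (intro AE_I2) (simp add: less_imp_le order_trans[OF _ abs_ge_self])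
    qed
  qed
  have L1: "((\<lambda>t. \<integral>x. \<bar>?n t x - ?n 0 x\<bar> \<partial>lborel) \<longlongrightarrow> 0) (at_right 0)"
  proof (rule tendsto_at_right_sequentially[of 0 1])
    obtain K where K: "\<And>t x. t \<in> {0..1} \<Longrightarrow> ?n t x \<le> K * (1 + x \<bullet> x) powr \<beta>" using nbound[OF order_refl zero_le_one] by blast
    fix S :: "nat \<Rightarrow> real" assume S: "\<And>i. 0 < S i" "\<And>i. S i < 1" "S \<longlonglongrightarrow> 0"
    have "(\<lambda>i. \<integral>x. \<bar>?n (S i) x - ?n 0 x\<bar> \<partial>lborel) \<longlonglongrightarrow> (\<integral>x. 0 \<partial>(lborel :: 'a measure))"
    proof (rule integral_dominated_convergence)
      show "integrable lborel (\<lambda>x::'a. K * (1 + x \<bullet> x) powr \<beta>)" using base by (rule integrable_mult_right)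
      show "AE x in lborel. (\<lambda>i. \<bar>?n (S i) x - ?n 0 x\<bar>) \<longlonglongrightarrow> 0"
      proof (rule AE_I2)
        fix x
        have "(\<lambda>i. U (S i) x) \<longlonglongrightarrow> U 0 x"
          unfolding U_def A_def B_def using q by (intro tendsto_intros S) auto
        then have lim: "(\<lambda>i. ?n (S i) x) \<longlonglongrightarrow> ?n 0 x"
          unfolding n_eq using U[of 0 x] by (intro tendsto_powr tendsto_const) auto
        have "(\<lambda>i. \<bar>?n (S i) x - ?n 0 x\<bar>) \<longlonglongrightarrow> \<bar>?n 0 x - ?n 0 x\<bar>"
          by (intro tendsto_rabs tendsto_diff tendsto_const lim)
        then show "(\<lambda>i. \<bar>?n (S i) x - ?n 0 x\<bar>) \<longlonglongrightarrow> 0" by simp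
      qed
      show "AE x in lborel. norm \<bar>?n (S i) x - ?n 0 x\<bar> \<le> K * (1 + x \<bullet> x) powr \<beta>" for i
      proof (rule AE_I2)
        fix x
        show "norm \<bar>?n (S i) x - ?n 0 x\<bar> \<le> K * (1 + x \<bullet> x) powr \<beta>"
          using K[of "S i" x] K[of 0 x] npos[of "S i" x] npos[of 0 x] S(1,2)[of i] by simp
      qed
      show "(\<lambda>x. \<bar>?n (S i) x - ?n 0 x\<bar>) \<in> borel_measurable lborel" for i
        using meas by measurable
    qed auto
    then show "(\<lambda>i. \<integral>x. \<bar>?n (S i) x - ?n 0 x\<bar> \<partial>lborel) \<longlonglongrightarrow> 0" by simp
  qed simp
  show "cauchy_solution \<gamma> (?n 0) ?n"
    unfolding cauchy_solution_def
  proof (intro conjI allI impI)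
    fix t :: real and x :: 'a assume t: "t > 0"
    show "?n t x > 0" using npos t by simp
    show "((\<lambda>s. ?n s x) has_real_derivative divergence (\<lambda>y. ?n t y *\<^sub>R grad (pressure \<gamma> ?n t) y) x) (at t)"
      using dt[OF t] unfolding pde[OF t] .
    show "integrable lborel (?n t)" using int t by simp
  qed (fact C12 L1)+
  show "integrable lborel (?n 0)" by (rule int) simp
  show "t > 0 \<Longrightarrow> pressure \<gamma> ?n t x = - barenblatt_pressure \<gamma> t x"
    by (simp add: pressure_def n\<gamma> U_eq)
  show "t > 0 \<Longrightarrow> grad (pressure \<gamma> ?n t) x = (- 1 / ((real DIM('a) * \<gamma> + 2) * (t + 1))) *\<^sub>R x"
    unfolding d_def[symmetric] q_def[symmetric] using q by (simp add: gradp B_def)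
qed

theorem corollary1p16:
  fixes \<gamma> \<alpha> :: real
  assumes dim: "DIM('a::euclidean_space) \<ge> 2"
    and gamma: "- 2 / real DIM('a) < \<gamma>" "\<gamma> < 0"
    and alpha: "\<alpha> = 1 / (real DIM('a) * \<gamma> + 2)"
  shows
    "(\<forall>(n0 :: 'a \<Rightarrow> real) n.
        integrable lborel n0 \<longrightarrow> (AE x in lborel. n0 x \<ge> 0) \<longrightarrow> cauchy_solution \<gamma> n0 n \<longrightarrow>
        (\<forall>t>0. \<forall>x.
           (\<lambda>y. sqrt \<bar>pressure \<gamma> n t y\<bar>) differentiable (at x) \<and>
           (norm (grad (\<lambda>y. sqrt \<bar>pressure \<gamma> n t y\<bar>) x))\<^sup>2 \<le> 2 * \<alpha> / t \<and>
           (norm (grad (pressure \<gamma> n t) x))\<^sup>2 / \<bar>pressure \<gamma> n t x\<bar> \<le> 2 * \<alpha> / t)) \<and>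
     (\<forall>C < 2 * \<alpha>. \<exists>(n0 :: 'a \<Rightarrow> real) n t x.
        integrable lborel n0 \<and> (AE x in lborel. n0 x \<ge> 0) \<and> cauchy_solution \<gamma> n0 n \<and> t > 0 \<and>
        (norm (grad (pressure \<gamma> n t) x))\<^sup>2 / \<bar>pressure \<gamma> n t x\<bar> > C / t)"
proof (intro conjI allI impI)
  fix n0 :: "'a \<Rightarrow> real" and n t x
  assume sol: "cauchy_solution \<gamma> n0 n" and t: "(t::real) > 0"
  note * = cauchy_solution_gradient_bounds[OF dim gamma alpha sol t, of x]
  show "(\<lambda>y. sqrt \<bar>pressure \<gamma> n t y\<bar>) differentiable (at x)" by (rule *)
  show "(norm (grad (\<lambda>y. sqrt \<bar>pressure \<gamma> n t y\<bar>) x))\<^sup>2 \<le> 2 * \<alpha> / t" by (rule *)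
  show "(norm (grad (pressure \<gamma> n t) x))\<^sup>2 / \<bar>pressure \<gamma> n t x\<bar> \<le> 2 * \<alpha> / t" by (rule *)
next
  fix C :: real assume C: "C < 2 * \<alpha>"
  define q where "q = real DIM('a) * \<gamma> + 2"
  have q: "q > 0" using gamma dim by (simp add: q_def field_simps)
  have \<alpha>q: "\<alpha> = 1 / q" by (simp add: alpha q_def)
  \<comment> \<open>Chosen so that C < t (2 \<alpha> - C), that is, C/t < 2 \<alpha>/(t + 1): the
    shift of the time origin no longer matters. The absolute value covers negative
    \<open>C\<close>.\<close>
  define t where "t = \<bar>C\<bar> / (2 * \<alpha> - C) + 1"
  have t: "t > 0" using C by (simp add: t_def add_nonneg_pos)
  have Ct: "C / t < 2 * \<alpha> / (t + 1)"
  proof -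
    have "C \<le> \<bar>C\<bar> / (2 * \<alpha> - C) * (2 * \<alpha> - C)" using C by simp
    also have "\<dots> < t * (2 * \<alpha> - C)" using C by (intro mult_strict_right_mono) (auto simp: t_def)
    finally show ?thesis using t by (simp add: field_simps)
  qed
  define k where "k = 1 / (q * (t + 1))"
  define A where "A = (t + 1) powr (- real DIM('a) * \<gamma> / q)"
  have k: "k > 0" using q t by (simp add: k_def)
  have A: "A > 0" using t by (simp add: A_def)
  have gap: "2 * k - C / t > 0" using Ct by (simp add: k_def \<alpha>q)
  \<comment> \<open>At squared radius \<rho> the quotient is k^2 \<rho> / (A + k \<rho> / 2), which
    tends to 2 k = 2 \<alpha>/(t + 1) as \<rho> grows. It exceeds C/t once \<rho> k (2 k - C/t) / 2
    exceeds A C/t, and this \<rho> ensures it.\<close>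
  define \<rho> where "\<rho> = (\<bar>C / t\<bar> * A + 1) / (k / 2 * (2 * k - C / t))"
  have \<rho>: "\<rho> > 0" unfolding \<rho>_def using k gap A by (intro divide_pos_pos mult_pos_pos add_nonneg_pos) auto
  obtain b :: 'a where b: "b \<in> Basis" using nonempty_Basis by blast
  define x where "x = sqrt \<rho> *\<^sub>R b"
  have xx: "x \<bullet> x = \<rho>" using \<rho> b by (simp add: x_def inner_Basis)
  let ?n = "barenblatt \<gamma> :: real \<Rightarrow> 'a \<Rightarrow> real"
  note bar = barenblatt_solution[OF gamma]
  have "grad (pressure \<gamma> ?n t) x = (- k) *\<^sub>R x"
    using bar(4)[OF t, of x] by (simp add: k_def q_def)
  then have num: "(norm (grad (pressure \<gamma> ?n t) x))\<^sup>2 = k\<^sup>2 * \<rho>"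
    by (simp add: power_mult_distrib power2_norm_eq_inner xx)
  have U: "barenblatt_pressure \<gamma> t x = A + k / 2 * \<rho>"
    by (simp add: barenblatt_pressure_def A_def k_def q_def xx)
  have Upos: "A + k / 2 * \<rho> > 0" using A k \<rho> by (simp add: add_pos_pos)
  have den: "\<bar>pressure \<gamma> ?n t x\<bar> = A + k / 2 * \<rho>"
    using Upos by (simp add: bar(3)[OF t] U)
  have "C / t * (A + k / 2 * \<rho>) < k\<^sup>2 * \<rho>"
  proof -
    have "C / t * A \<le> \<bar>C / t\<bar> * A" by (rule mult_right_mono[OF abs_ge_self]) (use A in simp)
    then have "C / t * A < \<bar>C / t\<bar> * A + 1" by linarith
    also have "\<dots> = \<rho> * (k / 2 * (2 * k - C / t))" using k gap by (simp add: \<rho>_def)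
    finally show ?thesis by (simp add: algebra_simps power2_eq_square)
  qed
  then have "C / t < (norm (grad (pressure \<gamma> ?n t) x))\<^sup>2 / \<bar>pressure \<gamma> ?n t x\<bar>"
    unfolding num den using Upos by (simp only: pos_less_divide_eq)
  moreover have "AE x in lborel. ?n 0 x \<ge> 0" by (simp add: barenblatt_def)
  ultimately show "\<exists>(n0 :: 'a \<Rightarrow> real) n t x.
      integrable lborel n0 \<and> (AE x in lborel. n0 x \<ge> 0) \<and> cauchy_solution \<gamma> n0 n \<and> t > 0 \<and>
      (norm (grad (pressure \<gamma> n t) x))\<^sup>2 / \<bar>pressure \<gamma> n t x\<bar> > C / t"
    using bar(1,2) t by blast
qed

end
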